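(* Under the assumptions on the domain, time discretization, partitions and potentials listed in the context, let $\xi\in[0,\infty]$, let $(\phi_{h,\xi}^{n-1},r_{h,\xi}^{n-1},s_{h,\xi}^{n-1})\in U_h^\Omega\times\mathbb{R}\times\mathbb{R}$ be given and let the time increment $\tau>0$ be arbitrary. Then there exists a unique quintuple $$(\phi_{h,\xi}^n,\mu_{h,\xi}^n,\theta_{h,\xi}^n,r_{h,\xi}^n,s_{h,\xi}^n)\in U_h^\Omega\times U_h^\Omega\times U_h^\Gamma\times\mathbb{R}\times\mathbb{R}$$ which solves the discrete scheme (i)--(v) of the context.
   Context: **Domain and data.** $\Omega\subset\mathbb{R}^d$, $d\in\{2,3\}$, is a bounded, convex, polygonal (resp. polyhedral) domain, $\Gamma:=\partial\Omega$; $\nabla_\Gamma$ is the surface gradient on $\Gamma$; $\beta>0$ is a constant. The trace operator on $\Gamma$ is often suppressed in the notation. **Time discretization.** $T>0$, $N\in\mathbb{N}$, $\tau=T/N$, $t^n=n\tau$; $\partial_\tau^-a^n:=\tau^{-1}(a^n-a^{n-1})$. **Partitions.** $\{\mathcal{T}_h\}_{h>0}$ is a quasiuniform family of (conforming) partitions of $\Omega$ into disjoint open simplices $K$ with $\overline\Omega=\bigcup_{K}\overline K$, $\max_K\mathrm{diam}(K)\le h$. $\{\mathcal{T}_h^\Gamma\}_{h>0}$ is a quasiuniform family of partitions of $\Gamma$ into disjoint open simplices $K^\Gamma$ such that for every $K^\Gamma\in\mathcal{T}_h^\Gamma$ there is a unique $K\in\mathcal{T}_h$ with $\overline{K^\Gamma}=\overline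 K\cap\Gamma$, $\Gamma=\bigcup\overline{K^\Gamma}$, $\max\mathrm{diam}(K^\Gamma)\le h$ (so the elements of $\mathcal{T}_h^\Gamma$ are edges/faces of elements of $\mathcal{T}_h$). **Discrete spaces.** $U_h^\Omega$ is the space of continuous piecewise linear functions on $\mathcal{T}_h$; $U_h^\Gamma$ is the space of continuous piecewise linear functions on $\mathcal{T}_h^\Gamma$, i.e. the traces of functions in $U_h^\Omega$. $\mathcal{I}_h:C^0(\overline\Omega)\to U_h^\Omega$ and $\mathcal{I}_h^\Gamma:C^0(\Gamma)\to U_h^\Gamma$ are the nodal interpolation operators (values at the vertices of $\mathcal{T}_h$, resp. $\mathcal{T}_h^\Gamma$). **Potentials.** $F,G\in C^1(\mathbb{R})$ satisfy: (a) there is $\gamma>0$ with $E_h^\Omega(\zeta_h):=\int_\Omega\mathcal{I}_h\{F(\zeta_h)\}\,dx\ge\gamma$ and $E_h^\Gamma(\tilde\zeta_h):=\int_\Gamma\mathcal{I}_h^\Gamma\{G(\tilde\zeta_h)\}\,d\Gamma\ge\gamma$ for all $\zeta_h\in U_h^\Omega$, $\tilde\zeta_h\in U_h^\Gamma$, uniformly in $h$; (b) $|F(\zeta)|,|G(\zeta)|\le C(1+|\zeta|^4)$ and $|F'(\zeta)|,|G'(\zeta)|\le C(1+|\zeta|^3)$; (c) $F=F_1+F_2$, $G=G_1+G_2$ with $F_1,G_1\in C^{1,1}(\mathbb{R})$, $F_2,G_2\in C^2(\mathbb{R})$, $|F_2''(\zeta)|,|G_2''(\zeta)|\le C(1+|\zeta|^2)$.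 **Discrete scheme.** Let $\xi\in[0,\infty]$ (for $\xi=\infty$: $\frac1{1+\xi}:=0$, $\frac{\xi}{1+\xi}:=1$). Given $(\phi_{h,\xi}^{n-1},r_{h,\xi}^{n-1},s_{h,\xi}^{n-1})\in U_h^\Omega\times\mathbb{R}\times\mathbb{R}$, find $(\phi_{h,\xi}^n,\mu_{h,\xi}^n,\theta_{h,\xi}^n,r_{h,\xi}^n,s_{h,\xi}^n)\in U_h^\Omega\times U_h^\Omega\times U_h^\Gamma\times\mathbb{R}\times\mathbb{R}$ such that for all $\psi_h,\hat\psi_h\in U_h^\Omega$, $\eta_h\in U_h^\Gamma$: (i) $\int_\Omega\mathcal{I}_h\{\partial_\tau^-\phi_{h,\xi}^n\psi_h\}dx+\int_\Omega\nabla\mu_{h,\xi}^n\cdot\nabla\psi_h\,dx+\beta^{-1}\int_\Gamma\mathcal{I}_h^\Gamma\{\partial_\tau^-\phi_{h,\xi}^n\psi_h\}d\Gamma+\beta^{-1}\int_\Gamma\nabla_\Gamma\theta_{h,\xi}^n\cdot\nabla_\Gamma\psi_h\,d\Gamma=0$; (ii) $\frac1{1+\xi}\int_\Gamma\mathcal{I}_h^\Gamma\{\partial_\tau^-\phi_{h,\xi}^n\eta_h\}d\Gamma+\frac1{1+\xi}\int_\Gamma\nabla_\Gamma\theta_{h,\xi}^n\cdot\nabla_\Gamma\eta_h\,d\Gamma+\frac{\xi}{1+\xi}\beta\int_\Gamma\mathcal{I}_h^\Gamma\{(\beta\theta_{h,\xi}^n-\mu_{h,\xi}^n)\eta_h\}d\Gamma=0$;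 (iii) $\int_\Omega\mathcal{I}_h\{\mu_{h,\xi}^n\hat\psi_h\}dx+\int_\Gamma\mathcal{I}_h^\Gamma\{\theta_{h,\xi}^n\hat\psi_h\}d\Gamma=\int_\Omega\nabla\phi_{h,\xi}^n\cdot\nabla\hat\psi_h\,dx+\int_\Gamma\nabla_\Gamma\phi_{h,\xi}^n\cdot\nabla_\Gamma\hat\psi_h\,d\Gamma+\frac{r_{h,\xi}^n}{\sqrt{E_h^\Omega(\phi_{h,\xi}^{n-1})}}\int_\Omega\mathcal{I}_h\{F'(\phi_{h,\xi}^{n-1})\hat\psi_h\}dx+\frac{s_{h,\xi}^n}{\sqrt{E_h^\Gamma(\phi_{h,\xi}^{n-1})}}\int_\Gamma\mathcal{I}_h^\Gamma\{G'(\phi_{h,\xi}^{n-1})\hat\psi_h\}d\Gamma$; (iv) $r_{h,\xi}^n=r_{h,\xi}^{n-1}+\frac1{2\sqrt{E_h^\Omega(\phi_{h,\xi}^{n-1})}}\int_\Omega\mathcal{I}_h\{F'(\phi_{h,\xi}^{n-1})(\phi_{h,\xi}^n-\phi_{h,\xi}^{n-1})\}dx$; (v) $s_{h,\xi}^n=s_{h,\xi}^{n-1}+\frac1{2\sqrt{E_h^\Gamma(\phi_{h,\xi}^{n-1})}}\int_\Gamma\mathcal{I}_h^\Gamma\{G'(\phi_{h,\xi}^{n-1})(\phi_{h,\xi}^n-\phi_{h,\xi}^{n-1})\}d\Gamma$. *)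

theory Defs
  imports "HOL-Analysis.Analysis"
begin

text \<open>
  A function on a closed set \<open>S\<close> (the closure of the domain, or its boundary) is represented by a
  total function; membership in a finite element space on \<open>S\<close> fixes the values off \<open>S\<close> to be zero, so
  that equality of two members is equality of functions on \<open>S\<close>.  No operation below on such
  functions depends on the values off \<open>S\<close>.
\<close>

section \<open>Polyhedral domains and integration over their boundary\<close>

definition convex_polyhedral_domain :: "'a::euclidean_space set \<Rightarrow> bool" where
  "convex_polyhedral_domain \<Omega> \<longleftrightarrow>
     open \<Omega> \<and> \<Omega> \<noteq> {} \<and> bounded \<Omega> \<and> convex \<Omega> \<and> polytope (closure \<Omega>)"

text \<open>
  The unit normal to \<open>\<Omega>\<close>, pointing outward, which is common to all points of \<open>A\<close>.  It is used for
  \<open>A\<close> a facet of the closure of \<open>\<Omega>\<close>, and for \<open>A\<close> a single boundary point; in the latter case it is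
  well defined exactly at the points in the relative interior of a facet.
\<close>
definition outer_normal :: "'a::euclidean_space set \<Rightarrow> 'a set \<Rightarrow> 'a" where
  "outer_normal \<Omega> A = (THE \<nu>. norm \<nu> = 1 \<and> (\<forall>x\<in>A. \<forall>y\<in>\<Omega>. \<nu> \<bullet> (y - x) \<le> 0))"

text \<open>
  The surface measure on the boundary is the sum over the (flat) facets of the \<open>(d-1)\<close>-dimensional
  Lebesgue measure.  For a subset of a hyperplane with unit normal \<open>\<nu>\<close>, the latter is the
  \<open>d\<close>-dimensional Lebesgue measure of the prism of height one over that set.
\<close>
definition prism :: "'a::euclidean_space \<Rightarrow> 'a set \<Rightarrow> 'a set" where
  "prism \<nu> A = {a + t *\<^sub>R \<nu> | a t. a \<in> A \<and> 0 \<le> t \<and> t \<le> 1}"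

definition surface_measure :: "'a::euclidean_space set \<Rightarrow> 'a measure" where
  "surface_measure \<Omega> = measure_of UNIV (sets borel)
     (\<lambda>A. \<Sum>\<Phi> | \<Phi> facet_of closure \<Omega>. emeasure lborel (prism (outer_normal \<Omega> \<Phi>) (A \<inter> \<Phi>)))"

text \<open>
  The outer normal of a facet is the unit normal of the supporting hyperplane that cuts it out, and
  the set function defining \<open>surface_measure\<close> is countably additive.
\<close>

lemma outer_normal_facet:
  fixes \<Omega> :: "'a::euclidean_space set"
  assumes dom: "convex_polyhedral_domain \<Omega>" and facet: "\<Phi> facet_of closure \<Omega>"
  obtains b where "norm (outer_normal \<Omega> \<Phi>) = 1"
    and "\<And>y. y \<in> closure \<Omega> \<Longrightarrow> outer_normal \<Omega> \<Phi> \<bullet> y \<le> b"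
    and "\<Phi> = closure \<Omega> \<inter> {x. outer_normal \<Omega> \<Phi> \<bullet> x = b}"
proof -
  have op: "open \<Omega>" and ne: "\<Omega> \<noteq> {}" and pt: "polytope (closure \<Omega>)"
    using dom by (auto simp: convex_polyhedral_domain_def)
  have face: "\<Phi> face_of closure \<Omega>" and \<Phi>ne: "\<Phi> \<noteq> {}"
    and dim: "aff_dim \<Phi> = aff_dim (closure \<Omega>) - 1"
    using facet by (auto simp: facet_of_def)
  have dim': "aff_dim \<Phi> = int DIM('a) - 1"
    using dim op ne by (simp add: aff_dim_open)
  obtain a c where ac: "closure \<Omega> \<subseteq> {x. a \<bullet> x \<le> c}" "\<Phi> = closure \<Omega> \<inter> {x. a \<bullet> x = c}"
    using face exposed_face_of_polyhedron[OF polytope_imp_polyhedron[OF pt]]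
    unfolding exposed_face_of_def by blast
  have a0: "a \<noteq> 0"
    using ac \<Phi>ne dim by (cases "c = 0") auto
  define \<nu> where "\<nu> = a /\<^sub>R norm a"
  define b where "b = c / norm a"
  have le: "\<nu> \<bullet> y \<le> b" if "y \<in> closure \<Omega>" for y
    using a0 ac(1) that by (auto simp: \<nu>_def b_def divide_simps)
  have n1: "norm \<nu> = 1" using a0 by (simp add: \<nu>_def)
  then have n0: "\<nu> \<noteq> 0" by auto
  have eq: "\<Phi> = closure \<Omega> \<inter> {x. \<nu> \<bullet> x = b}"
    using a0 ac(2) by (auto simp: \<nu>_def b_def divide_simps)
  have "outer_normal \<Omega> \<Phi> = \<nu>"
    unfolding outer_normal_def
  proof (rule the_equality)
    show "norm \<nu> = 1 \<and> (\<forall>x\<in>\<Phi>. \<forall>y\<in>\<Omega>. \<nu> \<bullet> (y - x) \<le> 0)"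
      using n1 le eq closure_subset[of \<Omega>] by (auto simp: inner_diff_right)
  next
    fix \<nu>' assume asm: "norm \<nu>' = 1 \<and> (\<forall>x\<in>\<Phi>. \<forall>y\<in>\<Omega>. \<nu>' \<bullet> (y - x) \<le> 0)"
    have cl: "\<nu>' \<bullet> y \<le> \<nu>' \<bullet> x" if "x \<in> \<Phi>" "y \<in> closure \<Omega>" for x y
    proof -
      have "closure \<Omega> \<subseteq> {y. \<nu>' \<bullet> y \<le> \<nu>' \<bullet> x}"
        using asm that(1) by (intro closure_minimal closed_halfspace_le) (auto simp: inner_diff_right)
      then show ?thesis using that(2) by auto
    qed
    obtain p where p: "p \<in> \<Phi>" using \<Phi>ne by auto
    have sub: "\<Phi> \<subseteq> {x. \<nu>' \<bullet> x = \<nu>' \<bullet> p}"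
      using cl p eq by (auto intro!: antisym)
    have h1: "affine hull \<Phi> = {x. \<nu> \<bullet> x = b}"
    proof (rule affine_dim_equal)
      show "affine hull \<Phi> \<subseteq> {x. \<nu> \<bullet> x = b}"
        using eq by (intro hull_minimal affine_hyperplane) auto
      show "aff_dim (affine hull \<Phi>) = aff_dim {x. \<nu> \<bullet> x = b}"
        using dim' n0 by (simp add: aff_dim_hyperplane)
    qed (use \<Phi>ne in \<open>auto simp: affine_hyperplane\<close>)
    have h2: "affine hull \<Phi> \<subseteq> {x. \<nu>' \<bullet> x = \<nu>' \<bullet> p}"
      using sub by (intro hull_minimal affine_hyperplane)
    define w where "w = \<nu>' - (\<nu> \<bullet> \<nu>') *\<^sub>R \<nu>"
    have nn: "\<nu> \<bullet> \<nu> = 1" using n1 by (simp add: norm_eq_1)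
    have "\<nu> \<bullet> w = 0" by (simp add: w_def inner_diff_right nn)
    then have "p + w \<in> affine hull \<Phi>" using p eq h1 by (auto simp: inner_add_right)
    then have "\<nu>' \<bullet> w = 0" using h2 by (auto simp: inner_add_right)
    with \<open>\<nu> \<bullet> w = 0\<close> have "w \<bullet> w = 0"
      by (subst (1) w_def) (simp add: inner_diff_left)
    then have \<nu>': "\<nu>' = (\<nu> \<bullet> \<nu>') *\<^sub>R \<nu>" by (simp add: w_def)
    define t where "t = \<nu> \<bullet> \<nu>'"
    have "\<bar>t\<bar> = 1" using \<nu>' asm n1 by (metis norm_scaleR mult.right_neutral t_def)
    moreover have "t \<noteq> -1"
    proof
      assume "t = -1"
      then have m: "\<nu>' = - \<nu>" using \<nu>' by (simp add: t_def)
      have "\<Omega> \<subseteq> {x. \<nu> \<bullet> x = b}"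
      proof
        fix y assume "y \<in> \<Omega>"
        then have y: "y \<in> closure \<Omega>" using closure_subset by auto
        show "y \<in> {x. \<nu> \<bullet> x = b}"
          using cl[OF p y] le[OF y] p eq m by auto
      qed
      then have "interior {x. \<nu> \<bullet> x = b} \<noteq> {}" using op ne by (metis interior_maximal subset_empty)
      then show False using n0 by (simp add: interior_hyperplane)
    qed
    ultimately have "t = 1" by linarith
    then show "\<nu>' = \<nu>" using \<nu>' by (simp add: t_def)
  qed
  then have N: "\<nu> = outer_normal \<Omega> \<Phi>" by (rule sym)
  show thesis
    by (rule that[OF n1[unfolded N] le[unfolded N] eq[unfolded N]])
qed

lemma emeasure_surface_measure:
  fixes \<Omega> :: "'a::euclidean_space set"
  assumes dom: "convex_polyhedral_domain \<Omega>" and A: "A \<in> sets borel"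
  shows "emeasure (surface_measure \<Omega>) A =
    (\<Sum>\<Phi> | \<Phi> facet_of closure \<Omega>. emeasure lborel (prism (outer_normal \<Omega> \<Phi>) (A \<inter> \<Phi>)))"
    (is "_ = ?m A")
proof -
  let ?\<nu> = "outer_normal \<Omega>"
  have prism: "\<exists>P f. P \<in> sets borel \<and> f \<in> borel_measurable borel \<and>
      (\<forall>A. prism (?\<nu> \<Phi>) (A \<inter> \<Phi>) = P \<inter> f -` A)"
    if facet: "\<Phi> facet_of closure \<Omega>" for \<Phi>
  proof -
    obtain \<nu> b where \<nu>: "?\<nu> \<Phi> = \<nu>" and n1: "norm \<nu> = 1"
      and eq: "\<Phi> = closure \<Omega> \<inter> {x. \<nu> \<bullet> x = b}"
      by (rule outer_normal_facet[OF dom facet]) (rule that[OF refl])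
    have nn: "\<nu> \<bullet> \<nu> = 1" using n1 by (simp add: norm_eq_1)
    define f where "f = (\<lambda>x. x - (\<nu> \<bullet> x - b) *\<^sub>R \<nu>)"
    define P where "P = f -` \<Phi> \<inter> {x. 0 \<le> \<nu> \<bullet> x - b} \<inter> {x. \<nu> \<bullet> x - b \<le> 1}"
    have cf: "continuous_on UNIV f" unfolding f_def by (intro continuous_intros)
    have "closed \<Phi>" unfolding eq by (intro closed_Int closed_closure closed_hyperplane)
    then have "closed P" unfolding P_def
      by (intro closed_Int closed_vimage cf closed_Collect_le continuous_intros) 
    moreover have "prism \<nu> (A \<inter> \<Phi>) = P \<inter> f -` A" for A
    proof (intro set_eqI iffI)
      fix x assume "x \<in> prism \<nu> (A \<inter> \<Phi>)"
      then obtain a t where x: "x = a + t *\<^sub>R \<nu>" "a \<in> A" "a \<in> \<Phi>" "0 \<le> t" "t \<le> 1"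
        by (auto simp: prism_def)
      have "\<nu> \<bullet> a = b" using x(3) eq by auto
      then have "\<nu> \<bullet> x - b = t" by (simp add: x(1) inner_add_right nn)
      then show "x \<in> P \<inter> f -` A" using x by (auto simp: P_def f_def)
    next
      fix x assume "x \<in> P \<inter> f -` A"
      then show "x \<in> prism \<nu> (A \<inter> \<Phi>)"
        unfolding prism_def P_def
        by (auto intro!: exI[of _ "f x"] exI[of _ "\<nu> \<bullet> x - b"] simp: f_def)
    qed
    ultimately show ?thesis
      using borel_measurable_continuous_onI[OF cf] by (intro exI[of _ P] exI[of _ f]) (auto simp: \<nu>)
  qed
  have "countably_additive (sets borel) ?m"
  proof (rule countably_additiveI)
    fix B :: "nat \<Rightarrow> 'a set"
    assume B: "range B \<subseteq> sets borel" "disjoint_family B"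
    have "(\<Sum>i. emeasure lborel (prism (?\<nu> \<Phi>) (B i \<inter> \<Phi>))) =
        emeasure lborel (prism (?\<nu> \<Phi>) ((\<Union>i. B i) \<inter> \<Phi>))" if facet: "\<Phi> facet_of closure \<Omega>" for \<Phi>
    proof -
      obtain P f where P: "P \<in> sets borel" "f \<in> borel_measurable borel"
        and pr: "\<And>A. prism (?\<nu> \<Phi>) (A \<inter> \<Phi>) = P \<inter> f -` A"
        using prism[OF facet] by blast
      have m: "range (\<lambda>i. P \<inter> f -` B i) \<subseteq> sets lborel"
        using P B(1) measurable_sets[OF P(2)] by (auto simp: image_subset_iff)
      have d: "disjoint_family (\<lambda>i. P \<inter> f -` B i)"
        using B(2) by (auto simp: disjoint_family_on_def)
      have "(\<Union>i. P \<inter> f -` B i) = P \<inter> f -` (\<Union>i. B i)" by blast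
      then show ?thesis
        unfolding pr using suminf_emeasure[OF m d] by argo
    qed
    then show "(\<Sum>i. ?m (B i)) = ?m (\<Union>i. B i)"
      by (subst suminf_sum[OF summableI]) (rule sum.cong, rule refl, simp)
  qed
  moreover have "positive (sets borel) ?m"
    by (auto simp: positive_def prism_def)
  moreover have "sigma_algebra UNIV (sets (borel :: 'a measure))"
    using sets.sigma_algebra_axioms[of "borel :: 'a measure"] by simp
  ultimately show ?thesis
    unfolding surface_measure_def using A by (intro emeasure_measure_of_sigma) auto
qed

definition vol_int :: "'a::euclidean_space set \<Rightarrow> ('a \<Rightarrow> real) \<Rightarrow> real" where
  "vol_int \<Omega> f = (LINT x:\<Omega>|lebesgue. f x)"

definition surf_int :: "'a::euclidean_space set \<Rightarrow> ('a \<Rightarrow> real) \<Rightarrow> real" where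
  "surf_int \<Omega> f = (LINT x:frontier \<Omega>|completion (surface_measure \<Omega>). f x)"

text \<open>
  Both gradients are pointwise ones.  For piecewise linear functions they exist almost everywhere
  and agree with the weak ones.
\<close>
definition grad :: "('a::euclidean_space \<Rightarrow> real) \<Rightarrow> 'a \<Rightarrow> 'a" where
  "grad f x = (THE D. GDERIV f x :> D)"

definition surf_grad :: "'a::euclidean_space set \<Rightarrow> ('a \<Rightarrow> real) \<Rightarrow> 'a \<Rightarrow> 'a" where
  "surf_grad \<Omega> f x = (THE D. D \<bullet> outer_normal \<Omega> {x} = 0 \<and>
      (f has_derivative (\<lambda>v. v \<bullet> D)) (at x within frontier \<Omega>))"

section \<open>Partitions\<close>

definition simplicial_partition ::
    "int \<Rightarrow> 'a::euclidean_space set \<Rightarrow> real \<Rightarrow> 'a set set \<Rightarrow> bool" where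
  "simplicial_partition k S h \<T> \<longleftrightarrow>
     finite \<T> \<and> (\<forall>K\<in>\<T>. \<exists>C. k simplex C \<and> K = rel_interior C) \<and> pairwise disjnt \<T> \<and>
     (\<Union>K\<in>\<T>. closure K) = S \<and> (\<forall>K\<in>\<T>. diameter K \<le> h)"

text \<open>
  Every element contains a ball (relative to its affine hull) whose radius is at least a fixed
  multiple of the largest diameter in the same partition.  The reference length is the actual mesh
  size, not \<open>h\<close>, since \<open>h\<close> ranges over all positive numbers, including those
  exceeding the diameter of the domain.
\<close>
definition quasiuniform :: "(real \<Rightarrow> 'a::euclidean_space set set) \<Rightarrow> bool" where
  "quasiuniform \<T> \<longleftrightarrow>
     (\<exists>\<rho>>0. \<forall>h>0. \<forall>K\<in>\<T> h. \<forall>K'\<in>\<T> h. \<exists>x\<in>K. ball x (\<rho> * diameter K') \<inter> affine hull K \<subseteq> K)"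

definition mesh_family ::
    "'a::euclidean_space set \<Rightarrow> (real \<Rightarrow> 'a set set) \<Rightarrow> (real \<Rightarrow> 'a set set) \<Rightarrow> bool" where
  "mesh_family \<Omega> \<T> \<T>\<Gamma> \<longleftrightarrow>
     quasiuniform \<T> \<and> quasiuniform \<T>\<Gamma> \<and>
     (\<forall>h>0.
        simplicial_partition (int DIM('a)) (closure \<Omega>) h (\<T> h) \<and>
        triangulation (closure ` \<T> h) \<and>
        simplicial_partition (int DIM('a) - 1) (frontier \<Omega>) h (\<T>\<Gamma> h) \<and>
        (\<forall>K\<Gamma>\<in>\<T>\<Gamma> h. \<exists>!K. K \<in> \<T> h \<and> closure K\<Gamma> = closure K \<inter> frontier \<Omega>))"

section \<open>Finite element spaces\<close>

definition pw_linear_space :: "'a::euclidean_space set \<Rightarrow> 'a set set \<Rightarrow> ('a \<Rightarrow> real) set" where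
  "pw_linear_space S \<T> =
     {u. continuous_on S u \<and> (\<forall>K\<in>\<T>. \<exists>a b. \<forall>x\<in>K. u x = a \<bullet> x + b) \<and> (\<forall>x. x \<notin> S \<longrightarrow> u x = 0)}"

abbreviation bulk_space :: "'a::euclidean_space set \<Rightarrow> 'a set set \<Rightarrow> ('a \<Rightarrow> real) set" where
  "bulk_space \<Omega> \<T> \<equiv> pw_linear_space (closure \<Omega>) \<T>"

abbreviation surf_space :: "'a::euclidean_space set \<Rightarrow> 'a set set \<Rightarrow> ('a \<Rightarrow> real) set" where
  "surf_space \<Omega> \<T>\<Gamma> \<equiv> pw_linear_space (frontier \<Omega>) \<T>\<Gamma>"

definition mesh_vertices :: "'a::euclidean_space set set \<Rightarrow> 'a set" where
  "mesh_vertices \<T> = {x. \<exists>K\<in>\<T>. x extreme_point_of closure K}"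

definition interp :: "'a::euclidean_space set \<Rightarrow> 'a set set \<Rightarrow> ('a \<Rightarrow> real) \<Rightarrow> 'a \<Rightarrow> real" where
  "interp S \<T> f = (THE u. u \<in> pw_linear_space S \<T> \<and> (\<forall>x\<in>mesh_vertices \<T>. u x = f x))"

text \<open>Integrals of nodal interpolants.\<close>

definition vol_int_h ::
    "'a::euclidean_space set \<Rightarrow> 'a set set \<Rightarrow> ('a \<Rightarrow> real) \<Rightarrow> real" where
  "vol_int_h \<Omega> \<T> f = vol_int \<Omega> (interp (closure \<Omega>) \<T> f)"

definition surf_int_h ::
    "'a::euclidean_space set \<Rightarrow> 'a set set \<Rightarrow> ('a \<Rightarrow> real) \<Rightarrow> real" where
  "surf_int_h \<Omega> \<T>\<Gamma> f = surf_int \<Omega> (interp (frontier \<Omega>) \<T>\<Gamma> f)"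

section \<open>Potentials\<close>

definition bulk_energy ::
    "'a::euclidean_space set \<Rightarrow> 'a set set \<Rightarrow> (real \<Rightarrow> real) \<Rightarrow> ('a \<Rightarrow> real) \<Rightarrow> real" where
  "bulk_energy \<Omega> \<T> F \<zeta> = vol_int_h \<Omega> \<T> (\<lambda>x. F (\<zeta> x))"

definition surf_energy ::
    "'a::euclidean_space set \<Rightarrow> 'a set set \<Rightarrow> (real \<Rightarrow> real) \<Rightarrow> ('a \<Rightarrow> real) \<Rightarrow> real" where
  "surf_energy \<Omega> \<T>\<Gamma> G \<zeta> = surf_int_h \<Omega> \<T>\<Gamma> (\<lambda>x. G (\<zeta> x))"

definition energies_bounded_below ::
    "'a::euclidean_space set \<Rightarrow> (real \<Rightarrow> 'a set set) \<Rightarrow> (real \<Rightarrow> 'a set set) \<Rightarrow>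
     (real \<Rightarrow> real) \<Rightarrow> (real \<Rightarrow> real) \<Rightarrow> bool" where
  "energies_bounded_below \<Omega> \<T> \<T>\<Gamma> F G \<longleftrightarrow>
     (\<exists>\<gamma>>0. \<forall>h>0.
        (\<forall>\<zeta>\<in>bulk_space \<Omega> (\<T> h). bulk_energy \<Omega> (\<T> h) F \<zeta> \<ge> \<gamma>) \<and>
        (\<forall>\<zeta>\<in>surf_space \<Omega> (\<T>\<Gamma> h). surf_energy \<Omega> (\<T>\<Gamma> h) G \<zeta> \<ge> \<gamma>))"

definition potential_growth :: "(real \<Rightarrow> real) \<Rightarrow> bool" where
  "potential_growth F \<longleftrightarrow>
     (\<exists>C. \<forall>\<zeta>. \<bar>F \<zeta>\<bar> \<le> C * (1 + \<bar>\<zeta>\<bar> ^ 4) \<and> \<bar>deriv F \<zeta>\<bar> \<le> C * (1 + \<bar>\<zeta>\<bar> ^ 3))"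

definition potential_splitting :: "(real \<Rightarrow> real) \<Rightarrow> bool" where
  "potential_splitting F \<longleftrightarrow>
     (\<exists>F1 F2. (\<forall>\<zeta>. F \<zeta> = F1 \<zeta> + F2 \<zeta>) \<and>
        F1 C1_differentiable_on UNIV \<and> (\<exists>L. L-lipschitz_on UNIV (deriv F1)) \<and>
        F2 C1_differentiable_on UNIV \<and> deriv F2 C1_differentiable_on UNIV \<and>
        (\<exists>C. \<forall>\<zeta>. \<bar>deriv (deriv F2) \<zeta>\<bar> \<le> C * (1 + \<bar>\<zeta>\<bar>\<^sup>2)))"

definition admissible_potentials ::
    "'a::euclidean_space set \<Rightarrow> (real \<Rightarrow> 'a set set) \<Rightarrow> (real \<Rightarrow> 'a set set) \<Rightarrow>
     (real \<Rightarrow> real) \<Rightarrow> (real \<Rightarrow> real) \<Rightarrow> bool" where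
  "admissible_potentials \<Omega> \<T> \<T>\<Gamma> F G \<longleftrightarrow>
     F C1_differentiable_on UNIV \<and> G C1_differentiable_on UNIV \<and>
     energies_bounded_below \<Omega> \<T> \<T>\<Gamma> F G \<and>
     potential_growth F \<and> potential_growth G \<and>
     potential_splitting F \<and> potential_splitting G"

section \<open>The discrete scheme\<close>

text \<open>The coefficients \<open>1/(1+\<xi>)\<close> and \<open>\<xi>/(1+\<xi>)\<close>, with values \<open>0\<close> and \<open>1\<close> at infinity.\<close>

definition coeff_fin :: "ennreal \<Rightarrow> real" where
  "coeff_fin \<xi> = (if \<xi> = \<infinity> then 0 else 1 / (1 + enn2real \<xi>))"

definition coeff_inf :: "ennreal \<Rightarrow> real" where
  "coeff_inf \<xi> = (if \<xi> = \<infinity> then 1 else enn2real \<xi> / (1 + enn2real \<xi>))"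

definition diff_quot :: "real \<Rightarrow> ('a \<Rightarrow> real) \<Rightarrow> ('a \<Rightarrow> real) \<Rightarrow> 'a \<Rightarrow> real" where
  "diff_quot \<tau> u u0 x = (u x - u0 x) / \<tau>"

text \<open>
  Here \<open>\<phi>0\<close>, \<open>r0\<close>, \<open>s0\<close> are the data from the previous time level.
\<close>
definition scheme_solution ::
    "'a::euclidean_space set \<Rightarrow> 'a set set \<Rightarrow> 'a set set \<Rightarrow> (real \<Rightarrow> real) \<Rightarrow> (real \<Rightarrow> real) \<Rightarrow>
     real \<Rightarrow> ennreal \<Rightarrow> real \<Rightarrow> ('a \<Rightarrow> real) \<Rightarrow> real \<Rightarrow> real \<Rightarrow>
     ('a \<Rightarrow> real) \<times> ('a \<Rightarrow> real) \<times> ('a \<Rightarrow> real) \<times> real \<times> real \<Rightarrow> bool" where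
  "scheme_solution \<Omega> \<T> \<T>\<Gamma> F G \<beta> \<xi> \<tau> \<phi>0 r0 s0 = (\<lambda>(\<phi>, \<mu>, \<theta>, r, s).
     \<phi> \<in> bulk_space \<Omega> \<T> \<and> \<mu> \<in> bulk_space \<Omega> \<T> \<and> \<theta> \<in> surf_space \<Omega> \<T>\<Gamma> \<and>
     (\<forall>\<psi>\<in>bulk_space \<Omega> \<T>.
        vol_int_h \<Omega> \<T> (\<lambda>x. diff_quot \<tau> \<phi> \<phi>0 x * \<psi> x)
        + vol_int \<Omega> (\<lambda>x. grad \<mu> x \<bullet> grad \<psi> x)
        + 1 / \<beta> * surf_int_h \<Omega> \<T>\<Gamma> (\<lambda>x. diff_quot \<tau> \<phi> \<phi>0 x * \<psi> x)
        + 1 / \<beta> * surf_int \<Omega> (\<lambda>x. surf_grad \<Omega> \<theta> x \<bullet> surf_grad \<Omega> \<psi> x) = 0) \<and>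
     (\<forall>\<eta>\<in>surf_space \<Omega> \<T>\<Gamma>.
        coeff_fin \<xi> * surf_int_h \<Omega> \<T>\<Gamma> (\<lambda>x. diff_quot \<tau> \<phi> \<phi>0 x * \<eta> x)
        + coeff_fin \<xi> * surf_int \<Omega> (\<lambda>x. surf_grad \<Omega> \<theta> x \<bullet> surf_grad \<Omega> \<eta> x)
        + coeff_inf \<xi> * \<beta> * surf_int_h \<Omega> \<T>\<Gamma> (\<lambda>x. (\<beta> * \<theta> x - \<mu> x) * \<eta> x) = 0) \<and>
     (\<forall>\<psi>\<in>bulk_space \<Omega> \<T>.
        vol_int_h \<Omega> \<T> (\<lambda>x. \<mu> x * \<psi> x) + surf_int_h \<Omega> \<T>\<Gamma> (\<lambda>x. \<theta> x * \<psi> x)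
        = vol_int \<Omega> (\<lambda>x. grad \<phi> x \<bullet> grad \<psi> x)
          + surf_int \<Omega> (\<lambda>x. surf_grad \<Omega> \<phi> x \<bullet> surf_grad \<Omega> \<psi> x)
          + r / sqrt (bulk_energy \<Omega> \<T> F \<phi>0) * vol_int_h \<Omega> \<T> (\<lambda>x. deriv F (\<phi>0 x) * \<psi> x)
          + s / sqrt (surf_energy \<Omega> \<T>\<Gamma> G \<phi>0) * surf_int_h \<Omega> \<T>\<Gamma> (\<lambda>x. deriv G (\<phi>0 x) * \<psi> x)) \<and>
     r = r0 + 1 / (2 * sqrt (bulk_energy \<Omega> \<T> F \<phi>0))
              * vol_int_h \<Omega> \<T> (\<lambda>x. deriv F (\<phi>0 x) * (\<phi> x - \<phi>0 x)) \<and>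
     s = s0 + 1 / (2 * sqrt (surf_energy \<Omega> \<T>\<Gamma> G \<phi>0))
              * surf_int_h \<Omega> \<T>\<Gamma> (\<lambda>x. deriv G (\<phi>0 x) * (\<phi> x - \<phi>0 x)))"

end

theory Submission
  imports Defs
begin

text \<open>
  The scheme is a square linear system, so uniqueness for the homogeneous system suffices.  Testing
  the homogeneous equations with \<open>\<psi> = \<mu>\<close>, \<open>\<eta> = \<theta> - \<mu> / \<beta>\<close> and \<open>\<phi> / \<tau>\<close> shows that a sum of
  nonnegative terms containing the gradients of \<open>\<phi>\<close>, \<open>\<mu>\<close>, \<open>\<theta>\<close> vanishes, so all three are constant.
  The first equation with \<open>\<psi> = 1\<close> gives \<open>\<phi> = 0\<close>.  The third equation, tested with the nodal basis
  function of an interior vertex and then with \<open>1\<close>, gives \<open>\<mu> = 0\<close> and \<open>\<theta> = 0\<close>; for \<open>\<xi> = 0\<close> this step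
  would fail on a mesh without interior vertices.
\<close>

section \<open>Galerkin problems in nodal spaces\<close>

text \<open>The energy argument rests on a cancellation. On the boundary,
  \<open>\<beta> * \<theta> - \<mu>\<close> is \<open>\<beta>\<close> times the test function
  \<open>\<theta> - \<mu> / \<beta>\<close>, so the coupling term of the second equation becomes a
  square of favourable sign. What remains of that equation, divided by the coefficient 1/(1+\<xi>),
  cancels the mixed boundary terms of the first equation. The division is impossible for \<xi> =
  \<infinity>, which is why that value is treated separately. The other obstacle lies in the forms.
  Both gradients are pointwise definite descriptions: their values on the skeleton of the mesh are
  unspecified, and on the boundary only tangential derivatives are determined. The stiffness
  integrals are therefore reduced to finite sums over cells, in one abstract setting that covers the
  domain with Lebesgue measure and the boundary with the completed surface measure.\<close>

lemma linear_system_solvable: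
  fixes A :: "'r \<Rightarrow> 'c \<Rightarrow> real"
  assumes "finite C" "finite R" "card R = card C"
    and "\<And>x. \<forall>i\<in>R. (\<Sum>j\<in>C. A i j * x j) = 0 \<Longrightarrow> \<forall>j\<in>C. x j = 0"
  shows "\<exists>x. \<forall>i\<in>R. (\<Sum>j\<in>C. A i j * x j) = b i"
  using assms
proof (induction C arbitrary: R A b rule: finite_induct)
  case empty
  then show ?case by auto
next
  case (insert c C)
  \<comment> \<open>Gaussian elimination on column \<open>c\<close>: it has a nonzero entry, since
    otherwise the unit vector of \<open>c\<close> would solve the homogeneous system. Rows and
    columns have separate index sets so that row \<open>r\<close> and column \<open>c\<close> can be
    deleted independently.\<close>
  obtain r where r: "r \<in> R" "A r c \<noteq> 0"
  proof (rule ccontr)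
    assume "\<not> thesis"
    with that have "\<forall>i\<in>R. A i c = 0" by blast
    with insert.hyps have "\<forall>i\<in>R. (\<Sum>j\<in>insert c C. A i j * (if j = c then 1 else 0)) = 0"
      by (simp add: if_distrib[of "(*) _"] sum.delta cong: if_cong)
    from insert.prems(3)[OF this] show False by auto
  qed
  \<comment> \<open>\<open>A'\<close> is the Schur complement of the pivot, and \<open>y t x\<close>
    extends \<open>x\<close> to column \<open>c\<close> so that row \<open>r\<close> takes the value
    \<open>t\<close>.\<close>
  define A' where "A' i j = A i j - A i c * A r j / A r c" for i j
  define y where "y t x = (\<lambda>j. if j = c then (t - (\<Sum>j\<in>C. A r j * x j)) / A r c else x j)" for t :: real and x
  have sum_y: "(\<Sum>j\<in>insert c C. A i j * y t x j) = (\<Sum>j\<in>C. A' i j * x j) + A i c * t / A r c" for i t x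
  proof -
    have "(\<Sum>j\<in>C. A i j * y t x j) = (\<Sum>j\<in>C. A i j * x j)"
      using insert.hyps by (intro sum.cong) (auto simp: y_def)
    moreover have "(\<Sum>j\<in>C. A' i j * x j) = (\<Sum>j\<in>C. A i j * x j) - A i c / A r c * (\<Sum>j\<in>C. A r j * x j)"
      by (simp add: A'_def algebra_simps sum_subtractf sum_distrib_left)
    ultimately show ?thesis
      using insert.hyps r(2) by (simp add: y_def field_simps)
  qed
  have r0: "A' r j = 0" for j using r(2) by (simp add: A'_def)
  have "\<exists>x. \<forall>i\<in>R - {r}. (\<Sum>j\<in>C. A' i j * x j) = b i - A i c * b r / A r c"
  proof (rule insert.IH)
    show "finite (R - {r})" using insert.prems by simp
    show "card (R - {r}) = card C" using insert.prems insert.hyps r by simp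
    show "\<forall>j\<in>C. x j = 0" if "\<forall>i\<in>R - {r}. (\<Sum>j\<in>C. A' i j * x j) = 0" for x
    proof -
      have "\<forall>i\<in>R. (\<Sum>j\<in>insert c C. A i j * y 0 x j) = 0"
        using that by (subst sum_y) (auto simp: r0 intro: sum.neutral)
      from insert.prems(3)[OF this] show ?thesis
        using insert.hyps by (auto simp: y_def split: if_splits)
    qed
  qed
  then obtain x where "\<forall>i\<in>R - {r}. (\<Sum>j\<in>C. A' i j * x j) = b i - A i c * b r / A r c" by blast
  then have "\<forall>i\<in>R. (\<Sum>j\<in>insert c C. A i j * y (b r) x j) = b i"
    using r(2) by (subst sum_y) (metis (no_types, lifting) DiffI add.commute add.left_neutral
      diff_add_cancel mult.commute nonzero_mult_div_cancel_left r0 singletonD sum.neutral mult_zero_left)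
  then show ?case by blast
qed

text \<open>Linearity is relative to a set because the stiffness forms are known to be linear only
  on piecewise affine functions.\<close>

definition linear_on :: "('i \<Rightarrow> real) set \<Rightarrow> (('i \<Rightarrow> real) \<Rightarrow> real) \<Rightarrow> bool" where
  "linear_on X l \<longleftrightarrow> (\<forall>u\<in>X. \<forall>v\<in>X. l (\<lambda>i. u i + v i) = l u + l v) \<and> (\<forall>c. \<forall>u\<in>X. l (\<lambda>i. c * u i) = c * l u)"

definition fun_subspace :: "('i \<Rightarrow> real) set \<Rightarrow> bool" where
  "fun_subspace X \<longleftrightarrow> (\<lambda>i. 0) \<in> X \<and> (\<forall>u\<in>X. \<forall>v\<in>X. (\<lambda>i. u i + v i) \<in> X) \<and> (\<forall>c. \<forall>u\<in>X. (\<lambda>i. c * u i) \<in> X)"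

text \<open>Unisolvence: the nodes index a basis, so the dimension enters only as the number of
  nodes.\<close>

definition nodal_space :: "('i \<Rightarrow> real) set \<Rightarrow> 'i set \<Rightarrow> bool" where
  "nodal_space X N \<longleftrightarrow> finite N \<and> fun_subspace X \<and> (\<forall>f. \<exists>!u. u \<in> X \<and> (\<forall>i\<in>N. u i = f i))"

lemma fun_subspaceD:
  assumes "fun_subspace X" "u \<in> X"
  shows "v \<in> X \<Longrightarrow> (\<lambda>i. u i + v i) \<in> X" "(\<lambda>i. c * u i) \<in> X"
  using assms by (auto simp: fun_subspace_def)

lemma linear_onD:
  assumes "linear_on X l" "u \<in> X"
  shows "v \<in> X \<Longrightarrow> l (\<lambda>i. u i + v i) = l u + l v" "l (\<lambda>i. c * u i) = c * l u"
  using assms by (auto simp: linear_on_def)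

lemma linear_on_sum:
  assumes X: "fun_subspace X" and l: "linear_on X l" and "finite J" "\<And>j. j \<in> J \<Longrightarrow> h j \<in> X"
  shows "(\<lambda>i. \<Sum>j\<in>J. c j * h j i) \<in> X \<and> l (\<lambda>i. \<Sum>j\<in>J. c j * h j i) = (\<Sum>j\<in>J. c j * l (h j))"
  using assms(3,4)
proof (induction J rule: finite_induct)
  case empty
  have "l (\<lambda>i. 0 * 0) = 0 * l (\<lambda>i. 0)"
    using X by (intro linear_onD(2)[OF l]) (auto simp: fun_subspace_def)
  then show ?case using X by (auto simp: fun_subspace_def)
next
  case (insert j J)
  have "(\<lambda>i. c j * h j i) \<in> X" using X insert by (auto simp: fun_subspace_def)
  with insert X show ?case
    by (auto simp: linear_onD[OF l] fun_subspace_def)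
qed

lemma nodal_space_unique:
  assumes "nodal_space X N" "u \<in> X" "v \<in> X" "\<And>i. i \<in> N \<Longrightarrow> u i = v i"
  shows "u = v"
  using assms unfolding nodal_space_def by metis

text \<open>Trial and test space agree, so the matrix in the nodal basis is square and injectivity
  gives solvability. Uniqueness is nondegeneracy applied to the difference of two solutions.\<close>

lemma nodal_galerkin:
  assumes X: "nodal_space X N"
    and B1: "\<And>y. y \<in> X \<Longrightarrow> linear_on X (\<lambda>x. B x y)" and B2: "\<And>x. x \<in> X \<Longrightarrow> linear_on X (B x)"
    and nondeg: "\<And>x. x \<in> X \<Longrightarrow> \<forall>y\<in>X. B x y = 0 \<Longrightarrow> \<forall>i\<in>N. x i = 0"
    and l: "linear_on X l"
  shows "\<exists>!x. x \<in> X \<and> (\<forall>y\<in>X. B x y = l y)"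
proof -
  have N: "finite N" and sub: "fun_subspace X" using X by (auto simp: nodal_space_def)
  have "\<exists>u. u \<in> X \<and> (\<forall>i\<in>N. u i = (if i = j then 1 else 0))" for j
    using X unfolding nodal_space_def
    by (elim conjE allE[of _ "\<lambda>i. if i = j then 1 else 0"]) (rule ex1_implies_ex)
  then obtain h where h: "\<And>j. h j \<in> X" "\<And>i j. i \<in> N \<Longrightarrow> h j i = (if i = j then 1 else 0)"
    by metis
  define comb where "comb c = (\<lambda>i. \<Sum>j\<in>N. c j * h j i)" for c
  have comb: "comb c \<in> X" for c
    unfolding comb_def by (rule conjunct1[OF linear_on_sum[OF sub l N]]) (rule h)
  have lcomb: "l' (comb c) = (\<Sum>j\<in>N. c j * l' (h j))" if "linear_on X l'" for l' c
    unfolding comb_def by (rule conjunct2[OF linear_on_sum[OF sub that N]]) (rule h)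
  have comb_at: "comb c i = c i" if "i \<in> N" for c i
    using N that by (simp add: comb_def h(2) if_distrib[of "(*) _"] cong: if_cong)
  have rep: "comb x = x" if "x \<in> X" for x
    using nodal_space_unique[OF X comb that] comb_at by auto
  have test: "\<forall>y\<in>X. l1 y = l2 y" if "linear_on X l1" "linear_on X l2" "\<forall>i\<in>N. l1 (h i) = l2 (h i)" for l1 l2
  proof
    fix y assume "y \<in> X"
    then have "l1 (comb y) = l2 (comb y)" using that by (simp add: lcomb)
    then show "l1 y = l2 y" using rep[OF \<open>y \<in> X\<close>] by simp
  qed
  have zero: "linear_on X (\<lambda>_. 0)" by (simp add: linear_on_def)
  have Bcomb: "B (comb c) (h i) = (\<Sum>j\<in>N. B (h j) (h i) * c j)" for c i
    using lcomb[OF B1[OF h(1)]] by (simp add: mult.commute)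
  have "\<exists>c. \<forall>i\<in>N. (\<Sum>j\<in>N. B (h j) (h i) * c j) = l (h i)"
  proof (rule linear_system_solvable[OF N N refl])
    fix c assume "\<forall>i\<in>N. (\<Sum>j\<in>N. B (h j) (h i) * c j) = 0"
    then have "\<forall>y\<in>X. B (comb c) y = 0"
      by (intro test B2 comb zero) (simp add: Bcomb)
    from nondeg[OF comb this] show "\<forall>j\<in>N. c j = 0" by (simp add: comb_at)
  qed
  then obtain c where "\<forall>i\<in>N. B (comb c) (h i) = l (h i)" by (auto simp: Bcomb)
  then have sol: "\<forall>y\<in>X. B (comb c) y = l y" by (intro test B2 comb l)
  show ?thesis
  proof (rule ex1I[of _ "comb c"])
    show "comb c \<in> X \<and> (\<forall>y\<in>X. B (comb c) y = l y)" using comb sol by blast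
    fix x assume x: "x \<in> X \<and> (\<forall>y\<in>X. B x y = l y)"
    define d where "d = (\<lambda>i. x i + (-1) * comb c i)"
    have m: "(\<lambda>i. (-1) * comb c i) \<in> X" by (rule fun_subspaceD(2)[OF sub comb])
    have dX: "d \<in> X" unfolding d_def by (rule fun_subspaceD(1)[OF sub conjunct1[OF x] m])
    have "B d y = 0" if y: "y \<in> X" for y
    proof -
      have "B d y = B x y + B (\<lambda>i. (-1) * comb c i) y"
        unfolding d_def using linear_onD(1)[OF B1[OF y] conjunct1[OF x] m] .
      then show ?thesis
        using linear_onD(2)[OF B1[OF y] comb, of "-1" c] sol x y by simp
    qed
    then have "\<forall>i\<in>N. d i = 0" by (intro nondeg dX) auto
    then show "x = comb c"
      by (intro nodal_space_unique[OF X _ comb]) (use x in \<open>auto simp: d_def\<close>)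
  qed
qed

text \<open>A pair of functions is encoded as one function on the disjoint sum of their domains, so
  that a coupled system is again a problem in a single nodal space.\<close>

definition fun_sum :: "('i \<Rightarrow> real) set \<Rightarrow> ('j \<Rightarrow> real) set \<Rightarrow> ('i + 'j \<Rightarrow> real) set" where
  "fun_sum X Y = {w. w \<circ> Inl \<in> X \<and> w \<circ> Inr \<in> Y}"

lemma nodal_space_fun_sum:
  assumes X: "nodal_space X N" and Y: "nodal_space Y M"
  shows "nodal_space (fun_sum X Y) (N <+> M)"
  unfolding nodal_space_def
proof (intro conjI allI)
  show "finite (N <+> M)" using X Y by (auto simp: nodal_space_def)
  show "fun_subspace (fun_sum X Y)"
    using X Y by (auto simp: nodal_space_def fun_subspace_def fun_sum_def o_def)
  fix f :: "'a + 'b \<Rightarrow> real"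
  obtain u where u: "u \<in> X" "\<forall>i\<in>N. u i = f (Inl i)"
    using X unfolding nodal_space_def by meson
  obtain v where v: "v \<in> Y" "\<forall>i\<in>M. v i = f (Inr i)"
    using Y unfolding nodal_space_def by meson
  show "\<exists>!w. w \<in> fun_sum X Y \<and> (\<forall>i\<in>N <+> M. w i = f i)"
  proof (rule ex1I[of _ "case_sum u v"])
    show "case_sum u v \<in> fun_sum X Y \<and> (\<forall>i\<in>N <+> M. case_sum u v i = f i)"
      using u v by (auto simp: fun_sum_def o_def)
    fix w assume w: "w \<in> fun_sum X Y \<and> (\<forall>i\<in>N <+> M. w i = f i)"
    have "w \<circ> Inl = u" using w u by (intro nodal_space_unique[OF X]) (auto simp: fun_sum_def)
    moreover have "w \<circ> Inr = v" using w v by (intro nodal_space_unique[OF Y]) (auto simp: fun_sum_def)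
    ultimately show "w = case_sum u v" by (auto simp: fun_eq_iff split: sum.split)
  qed
qed

section \<open>Nodal interpolation on simplicial meshes\<close>

text \<open>Translating one vertex to the origin makes the others linearly independent, so the
  prescribed increments extend to a linear functional. Its Riesz vector is the slope
  \<open>a\<close>.\<close>

lemma affine_interpolation:
  fixes V :: "'a::euclidean_space set"
  assumes "\<not> affine_dependent V"
  obtains a b where "\<And>v. v \<in> V \<Longrightarrow> a \<bullet> v + b = f v"
proof (cases "V = {}")
  case False
  then obtain v0 where v0: "v0 \<in> V" by blast
  define W where "W = V - {v0}"
  have V: "V = insert v0 W" "v0 \<notin> W" using v0 by (auto simp: W_def)
  have "independent ((\<lambda>x. - v0 + x) ` W)"
    using assms affine_dependent_iff_dependent[OF V(2)] V(1) by simp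
  then obtain g :: "'a \<Rightarrow> real" where g: "linear g"
    "\<forall>x\<in>(\<lambda>x. - v0 + x) ` W. g x = f (v0 + x) - f v0"
    using linear_independent_extend[of "(\<lambda>x. - v0 + x) ` W" "\<lambda>x. f (v0 + x) - f v0"] by blast
  define a where "a = adjoint g 1"
  have a: "a \<bullet> x = g x" for x
    using adjoint_works[OF g(1), of x 1] by (simp add: a_def inner_commute)
  show thesis
  proof (rule that[of a "f v0 - a \<bullet> v0"])
    fix v assume v: "v \<in> V"
    show "a \<bullet> v + (f v0 - a \<bullet> v0) = f v"
    proof (cases "v = v0")
      case False
      then have "g (- v0 + v) = f v - f v0" using g(2) v V by auto
      then show ?thesis using a[of "- v0 + v"] by (simp add: inner_diff_right)
    qed simp
  qed
qed (use that in auto)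

lemma affine_nonneg_convex_hull:
  fixes V :: "'a::euclidean_space set"
  assumes "\<And>v. v \<in> V \<Longrightarrow> a \<bullet> v + b \<ge> (0::real)" "x \<in> convex hull V"
  shows "a \<bullet> x + b \<ge> 0"
proof -
  have "convex hull V \<subseteq> {x. a \<bullet> x \<ge> -b}"
    using assms(1) by (intro hull_minimal convex_halfspace_ge subsetI CollectI) fastforce
  then show ?thesis using assms(2) by (auto simp: algebra_simps)
qed

lemma affine_eq_convex_hull:
  fixes V :: "'a::euclidean_space set"
  assumes "\<And>v. v \<in> V \<Longrightarrow> a \<bullet> v + b = a' \<bullet> v + (b'::real)" "x \<in> convex hull V"
  shows "a \<bullet> x + b = a' \<bullet> x + b'"
  using affine_nonneg_convex_hull[of V "a - a'" "b - b'" x]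
    affine_nonneg_convex_hull[of V "a' - a" "b' - b" x] assms
  by (force simp: algebra_simps)

text \<open>The segment from \<open>y\<close> to a relative interior point \<open>x\<close> can be
  prolonged beyond \<open>x\<close> inside \<open>C\<close>. An affine function that is zero at
  \<open>x\<close> and positive at \<open>y\<close> would be negative there.\<close>

lemma affine_nonneg_rel_interior_zero:
  fixes C :: "'a::euclidean_space set"
  assumes "convex C" and nn: "\<And>y. y \<in> C \<Longrightarrow> a \<bullet> y + b \<ge> (0::real)"
    and x: "x \<in> rel_interior C" "a \<bullet> x + b = 0" and y: "y \<in> C"
  shows "a \<bullet> y + b = 0"
proof -
  obtain e where e: "e > 1" "(1 - e) *\<^sub>R y + e *\<^sub>R x \<in> C"
    using convex_rel_interior_if2[OF assms(1) x(1)] hull_inc[OF y] by blast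
  have "a \<bullet> ((1 - e) *\<^sub>R y + e *\<^sub>R x) + b = (1 - e) * (a \<bullet> y + b) + e * (a \<bullet> x + b)"
    by (simp add: algebra_simps)
  then have "0 \<le> (1 - e) * (a \<bullet> y + b)" using nn[OF e(2)] x(2) by simp
  then show ?thesis using e(1) nn[OF y] by (simp add: zero_le_mult_iff)
qed

text \<open>The finite element functions without the normalization off \<open>S\<close>. Traces call
  for this larger class: a bulk function is piecewise affine on the boundary mesh but need not
  vanish off the boundary.\<close>

definition pw_affine :: "'a::euclidean_space set \<Rightarrow> 'a set set \<Rightarrow> ('a \<Rightarrow> real) set" where
  "pw_affine S \<T> = {u. continuous_on S u \<and> (\<forall>K\<in>\<T>. \<exists>a b. \<forall>x\<in>K. u x = a \<bullet> x + b)}"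

lemma fun_subspace_pw_affine: "fun_subspace (pw_affine S \<T>)"
proof -
  have "\<exists>a b. \<forall>x\<in>K. (0::real) = a \<bullet> x + b" for K :: "'a set"
    by (intro exI[of _ 0]) auto
  moreover have "\<exists>a b. \<forall>x\<in>K. u x + v x = a \<bullet> x + b"
    if "\<exists>a b. \<forall>x\<in>K. u x = a \<bullet> x + b" "\<exists>a b. \<forall>x\<in>K. v x = a \<bullet> x + b" for K :: "'a set" and u v :: "'a \<Rightarrow> real"
  proof -
    from that obtain a b a' b' where "\<forall>x\<in>K. u x = a \<bullet> x + b" "\<forall>x\<in>K. v x = a' \<bullet> x + b'" by blast
    then show ?thesis by (intro exI[of _ "a + a'"] exI[of _ "b + b'"]) (auto simp: algebra_simps)
  qed
  moreover have "\<exists>a b. \<forall>x\<in>K. c * u x = a \<bullet> x + b"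
    if "\<exists>a b. \<forall>x\<in>K. u x = a \<bullet> x + b" for K :: "'a set" and c and u :: "'a \<Rightarrow> real"
  proof -
    from that obtain a b where "\<forall>x\<in>K. u x = a \<bullet> x + b" by blast
    then show ?thesis by (intro exI[of _ "c *\<^sub>R a"] exI[of _ "c * b"]) (auto simp: algebra_simps)
  qed
  ultimately show ?thesis
    unfolding fun_subspace_def pw_affine_def by (auto intro!: continuous_intros)
qed

lemma pw_linear_space_eq: "pw_linear_space S \<T> = {u \<in> pw_affine S \<T>. \<forall>x. x \<notin> S \<longrightarrow> u x = 0}"
  by (auto simp: pw_linear_space_def pw_affine_def)

lemma fun_subspace_pw_linear_space: "fun_subspace (pw_linear_space S \<T>)"
  using fun_subspace_pw_affine[of S \<T>] by (auto simp: pw_linear_space_eq fun_subspace_def)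

text \<open>The dimension of the cells is left open, so that the bulk triangulation and the boundary
  mesh are both instances. \<open>face_cells\<close> is conformity; exchanging \<open>K\<close> and
  \<open>L\<close> gives the statement for the other cell.\<close>

locale simplicial_mesh =
  fixes S :: "'a::euclidean_space set" and \<T> :: "'a set set"
  assumes finite_mesh: "finite \<T>"
    and simplex_cell: "K \<in> \<T> \<Longrightarrow> \<exists>C k. k simplex C \<and> K = rel_interior C"
    and face_cells: "K \<in> \<T> \<Longrightarrow> L \<in> \<T> \<Longrightarrow> closure K \<inter> closure L face_of closure K"
    and cover: "(\<Union>K\<in>\<T>. closure K) = S"
begin

definition cell_vertices :: "'a set \<Rightarrow> 'a set" where
  "cell_vertices K = {x. x extreme_point_of closure K}"

lemma cell:
  assumes "K \<in> \<T>"
  shows "\<not> affine_dependent (cell_vertices K)" "closure K = convex hull cell_vertices K"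
    "K = rel_interior (closure K)" "compact (closure K)" "convex (closure K)"
proof -
  obtain C k where "k simplex C" and K: "K = rel_interior C" using simplex_cell[OF assms] by blast
  then obtain V where V: "finite V" "\<not> affine_dependent V" "C = convex hull V"
    by (auto simp: simplex)
  have "compact C" using V by (simp add: finite_imp_compact_convex_hull)
  moreover have "convex C" using V by simp
  ultimately have C: "closure K = C"
    by (simp add: K convex_closure_rel_interior compact_imp_closed)
  have "cell_vertices K = V"
    using extreme_point_of_convex_hull_affine_independent[OF V(2)] C V(3) by (simp add: cell_vertices_def)
  then show "\<not> affine_dependent (cell_vertices K)" "closure K = convex hull cell_vertices K"
    "K = rel_interior (closure K)" "compact (closure K)" "convex (closure K)"
    using V C K \<open>compact C\<close> by simp_all
qed

lemma compact_mesh: "compact S"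
  unfolding cover[symmetric] using finite_mesh cell(4) by (intro compact_UN) auto

lemma mesh_vertices_eq: "mesh_vertices \<T> = (\<Union>K\<in>\<T>. cell_vertices K)"
  by (auto simp: mesh_vertices_def cell_vertices_def)

lemma finite_mesh_vertices: "finite (mesh_vertices \<T>)"
  unfolding mesh_vertices_eq using finite_mesh cell(1) aff_independent_finite by blast

lemma cell_vertices_subset: "cell_vertices K \<subseteq> closure K"
  by (auto simp: cell_vertices_def extreme_point_of_def)

lemma mesh_vertices_subset: "mesh_vertices \<T> \<subseteq> S"
  unfolding mesh_vertices_eq cover[symmetric] using cell_vertices_subset by blast

lemma cell_subset: "K \<in> \<T> \<Longrightarrow> K \<subseteq> S" "K \<in> \<T> \<Longrightarrow> closure K \<subseteq> S"
  unfolding cover[symmetric] using closure_subset by blast+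

lemma pw_affine_closure:
  assumes u: "u \<in> pw_affine S \<T>" and K: "K \<in> \<T>"
  obtains a b where "\<And>x. x \<in> closure K \<Longrightarrow> u x = a \<bullet> x + b"
proof -
  obtain a b where ab: "\<And>x. x \<in> K \<Longrightarrow> u x = a \<bullet> x + b"
    using u K unfolding pw_affine_def by blast
  have cont: "continuous_on (closure K) (\<lambda>x. u x - (a \<bullet> x + b))"
    using u cell_subset[OF K] by (auto simp: pw_affine_def intro!: continuous_intros elim: continuous_on_subset)
  have "u x - (a \<bullet> x + b) = 0" if "x \<in> closure K" for x
    by (rule continuous_constant_on_closure[OF cont _ that]) (simp add: ab)
  then show thesis by (intro that[of a b]) (simp add: algebra_simps)
qed

text \<open>A discrete maximum principle: every value is a convex combination of the vertex values
  of one cell.\<close>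

lemma pw_affine_nonneg:
  assumes u: "u \<in> pw_affine S \<T>" and nn: "\<And>x. x \<in> mesh_vertices \<T> \<Longrightarrow> u x \<ge> 0" and x: "x \<in> S"
  shows "u x \<ge> 0"
proof -
  obtain K where K: "K \<in> \<T>" "x \<in> closure K" using x cover by blast
  obtain a b where ab: "\<And>x. x \<in> closure K \<Longrightarrow> u x = a \<bullet> x + b"
    by (rule pw_affine_closure[OF u K(1)], rule that)
  have "a \<bullet> x + b \<ge> 0"
  proof (rule affine_nonneg_convex_hull)
    show "x \<in> convex hull cell_vertices K" using K cell by simp
    fix v assume v: "v \<in> cell_vertices K"
    then have "v \<in> mesh_vertices \<T>" "v \<in> closure K"
      using K cell_vertices_subset by (auto simp: mesh_vertices_eq)
    then show "0 \<le> a \<bullet> v + b" using nn ab by metis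
  qed
  then show ?thesis using ab K by simp
qed

lemma pw_affine_unique:
  assumes u: "u \<in> pw_affine S \<T>" and v: "v \<in> pw_affine S \<T>"
    and eq: "\<And>x. x \<in> mesh_vertices \<T> \<Longrightarrow> u x = v x" and x: "x \<in> S"
  shows "u x = v x"
proof -
  have le: "v x \<le> u x" if "u \<in> pw_affine S \<T>" "v \<in> pw_affine S \<T>" "\<And>x. x \<in> mesh_vertices \<T> \<Longrightarrow> u x = v x" for u v
  proof -
    have "(\<lambda>x. u x + (-1) * v x) \<in> pw_affine S \<T>"
      by (intro fun_subspaceD fun_subspace_pw_affine that)
    then show ?thesis using pw_affine_nonneg[of "\<lambda>x. u x + (-1) * v x" x] that x by simp
  qed
  show ?thesis using le[OF u v eq] le[OF v u eq[symmetric]] by simp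
qed

lemma pw_linear_interpolant:
  "\<exists>u. u \<in> pw_linear_space S \<T> \<and> (\<forall>x\<in>mesh_vertices \<T>. u x = f x)"
proof -
  have "\<exists>a b. \<forall>v\<in>cell_vertices K. a \<bullet> v + b = f v" if "K \<in> \<T>" for K
    using affine_interpolation[OF cell(1)[OF that], of f] by metis
  then obtain a b where ab: "\<And>K v. K \<in> \<T> \<Longrightarrow> v \<in> cell_vertices K \<Longrightarrow> a K \<bullet> v + b K = f v"
    by metis
  \<comment> \<open>Two cells meet in a common face. This face is the hull of its extreme points,
    which are vertices of both cells, and there both affine functions take the value
    \<open>f\<close>.\<close>
  have agree: "a K \<bullet> x + b K = a L \<bullet> x + b L"
    if "K \<in> \<T>" "L \<in> \<T>" "x \<in> closure K" "x \<in> closure L" for K L x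
  proof -
    let ?F = "closure K \<inter> closure L"
    have FK: "?F face_of closure K" and FL: "?F face_of closure L"
      using face_cells[OF that(1,2)] face_cells[OF that(2,1)] by (simp_all add: Int_commute)
    have KM: "?F = convex hull {x. x extreme_point_of ?F}"
      using cell(4,5)[OF that(1)] cell(4,5)[OF that(2)]
      by (intro Krein_Milman_Minkowski compact_Int convex_Int) auto
    have "x \<in> ?F" using that by blast
    then have x: "x \<in> convex hull {x. x extreme_point_of ?F}" by (rule KM[THEN equalityD1, THEN subsetD])
    have "v \<in> cell_vertices K \<and> v \<in> cell_vertices L" if "v extreme_point_of ?F" for v
      using extreme_point_of_face[OF FK, of v] extreme_point_of_face[OF FL, of v] that
      by (simp add: cell_vertices_def)
    then have eq: "a K \<bullet> v + b K = a L \<bullet> v + b L" if "v extreme_point_of ?F" for v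
      using ab \<open>K \<in> \<T>\<close> \<open>L \<in> \<T>\<close> that by metis
    show ?thesis
      by (rule affine_eq_convex_hull[OF _ x], rule eq, erule CollectD)
  qed
  have "\<forall>x\<in>S. \<exists>K. K \<in> \<T> \<and> x \<in> closure K" using cover by blast
  \<comment> \<open>An arbitrary cell is chosen for each point; \<open>agree\<close> makes the value
    independent of the choice, so that continuity can be checked on the finitely many closed
    cells.\<close>
  then obtain c where c: "\<And>x. x \<in> S \<Longrightarrow> c x \<in> \<T> \<and> x \<in> closure (c x)" by metis
  define u where "u x = (if x \<in> S then a (c x) \<bullet> x + b (c x) else 0)" for x
  have u: "u x = a K \<bullet> x + b K" if "K \<in> \<T>" "x \<in> closure K" for K x
  proof -
    have x: "x \<in> S" using cell_subset(2)[OF that(1)] that(2) by (rule subsetD)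
    then show ?thesis using agree[of "c x" K x] c[OF x] that unfolding u_def by simp
  qed
  have "continuous_on S u"
    unfolding cover[symmetric]
  proof (rule continuous_on_closed_Union)
    fix K assume "K \<in> \<T>"
    have "continuous_on (closure K) (\<lambda>x. a K \<bullet> x + b K)" by (intro continuous_intros)
    then show "continuous_on (closure K) u" using u[OF \<open>K \<in> \<T>\<close>] by (simp cong: continuous_on_cong)
  qed (use finite_mesh in auto)
  moreover have "\<exists>a b. \<forall>x\<in>K. u x = a \<bullet> x + b" if "K \<in> \<T>" for K
    using u[OF that] closure_subset[of K] by blast
  moreover have "u x = f x" if "x \<in> mesh_vertices \<T>" for x
  proof -
    obtain K where "K \<in> \<T>" "x \<in> cell_vertices K"
      using \<open>x \<in> mesh_vertices \<T>\<close> unfolding mesh_vertices_eq by blast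
    then show ?thesis using u[of K x] ab[of K x] cell_vertices_subset[of K] by (simp add: subset_iff)
  qed
  ultimately show ?thesis by (intro exI[of _ u]) (auto simp: pw_linear_space_def u_def)
qed

lemma nodal_space_pw_linear: "nodal_space (pw_linear_space S \<T>) (mesh_vertices \<T>)"
  unfolding nodal_space_def
proof (intro conjI allI finite_mesh_vertices fun_subspace_pw_linear_space)
  fix f :: "'a \<Rightarrow> real"
  obtain u where u: "u \<in> pw_linear_space S \<T>" "\<forall>x\<in>mesh_vertices \<T>. u x = f x"
    using pw_linear_interpolant by blast
  show "\<exists>!u. u \<in> pw_linear_space S \<T> \<and> (\<forall>x\<in>mesh_vertices \<T>. u x = f x)"
  proof (rule ex1I[of _ u])
    fix v assume v: "v \<in> pw_linear_space S \<T> \<and> (\<forall>x\<in>mesh_vertices \<T>. v x = f x)"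
    show "v = u"
    proof
      fix x show "v x = u x"
        using pw_affine_unique[of v u x] u v by (cases "x \<in> S") (auto simp: pw_linear_space_eq)
    qed
  qed (use u in blast)
qed

section \<open>Nodal interpolation as a linear operator\<close>

lemma interp_spec:
  "interp S \<T> f \<in> pw_linear_space S \<T>" "x \<in> mesh_vertices \<T> \<Longrightarrow> interp S \<T> f x = f x"
proof -
  have "\<exists>!u. u \<in> pw_linear_space S \<T> \<and> (\<forall>x\<in>mesh_vertices \<T>. u x = f x)"
    using nodal_space_pw_linear unfolding nodal_space_def by blast
  from theI'[OF this] show "interp S \<T> f \<in> pw_linear_space S \<T>"
    "x \<in> mesh_vertices \<T> \<Longrightarrow> interp S \<T> f x = f x"
    unfolding interp_def by auto
qed

lemma interp_eqI:
  assumes "u \<in> pw_linear_space S \<T>" "\<And>x. x \<in> mesh_vertices \<T> \<Longrightarrow> u x = f x"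
  shows "interp S \<T> f = u"
  using nodal_space_unique[OF nodal_space_pw_linear interp_spec(1) assms(1), of f] interp_spec(2) assms(2)
  by simp

lemma interp_cong:
  assumes "\<And>x. x \<in> mesh_vertices \<T> \<Longrightarrow> f x = g x"
  shows "interp S \<T> f = interp S \<T> g"
  using assms interp_spec by (intro interp_eqI) auto

lemma interp_add: "interp S \<T> (\<lambda>x. f x + g x) = (\<lambda>x. interp S \<T> f x + interp S \<T> g x)"
  by (intro interp_eqI fun_subspaceD fun_subspace_pw_linear_space) (simp_all add: interp_spec)

lemma interp_cmult: "interp S \<T> (\<lambda>x. c * f x) = (\<lambda>x. c * interp S \<T> f x)"
  by (intro interp_eqI fun_subspaceD fun_subspace_pw_linear_space) (simp_all add: interp_spec)

lemma pw_linear_space_const: "(\<lambda>x. if x \<in> S then c else 0) \<in> pw_linear_space S \<T>"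
proof -
  have "continuous_on S (\<lambda>x. if x \<in> S then c else 0 :: real)"
    by (rule continuous_on_eq[of S "\<lambda>_. c"]) auto
  moreover have "\<exists>a b. \<forall>x\<in>K. (if x \<in> S then c else 0) = a \<bullet> x + b" if "K \<in> \<T>" for K
    using cell_subset[OF that] by (intro exI[of _ 0] exI[of _ c]) auto
  ultimately show ?thesis by (auto simp: pw_linear_space_def)
qed

lemma restrict_pw_affine:
  assumes u: "u \<in> pw_affine S \<T>"
  shows "(\<lambda>x. if x \<in> S then u x else 0) \<in> pw_linear_space S \<T>"
proof -
  have "continuous_on S (\<lambda>x. if x \<in> S then u x else 0)"
    using u by (auto simp: pw_affine_def cong: continuous_on_cong)
  moreover have "\<exists>a b. \<forall>x\<in>K. (if x \<in> S then u x else 0) = a \<bullet> x + b" if K: "K \<in> \<T>" for K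
  proof -
    obtain a b where "\<And>x. x \<in> K \<Longrightarrow> u x = a \<bullet> x + b" using u K unfolding pw_affine_def by blast
    then show ?thesis using cell_subset(1)[OF K] by (intro exI[of _ a] exI[of _ b]) auto
  qed
  ultimately show ?thesis by (auto simp: pw_linear_space_def)
qed

end

section \<open>Lumped mass and stiffness forms\<close>

text \<open>Completeness puts every subset of a null set into the sigma-algebra. This gives
  measurability of integrands built from pointwise gradients, whose values on the skeleton are
  unspecified.\<close>

lemma (in complete_measure) borel_measurable_AE_eq:
  assumes g: "g \<in> borel_measurable M" and ae: "AE x in M. f x = g x"
  shows "f \<in> borel_measurable M"
proof (rule measurableI)
  fix A :: "'b set" assume "A \<in> sets borel"
  then have "g -` A \<inter> space M \<in> sets M" using g by (rule measurable_sets[rotated])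
  then show "f -` A \<inter> space M \<in> sets M"
    by (rule in_sets_AE[rotated]) (use ae in auto)
qed simp

lemma rel_interior_borel:
  fixes C :: "'a::euclidean_space set"
  shows "rel_interior C \<in> sets borel"
proof -
  obtain U where "open U" "rel_interior C = affine hull C \<inter> U"
    using openin_rel_interior[of C] by (auto simp: openin_open)
  then show ?thesis by (simp add: borel_open borel_closed closed_affine_hull)
qed

text \<open>The difference lies in the span of \<open>B\<close> and is orthogonal to it, hence to
  itself.\<close>

lemma tangential_vector_unique:
  fixes d e :: "'a::euclidean_space"
  assumes "d \<in> span B" "e \<in> span B" "\<And>w. w \<in> B \<Longrightarrow> d \<bullet> w = e \<bullet> w"
  shows "d = e"
proof -
  have "orthogonal (d - e) (d - e)"
    by (rule orthogonal_to_span[OF span_diff[OF assms(1,2)]])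
      (simp add: orthogonal_def inner_diff_left assms(3))
  then show ?thesis by (simp add: orthogonal_def)
qed

text \<open>The instances are Lebesgue measure with \<open>grad\<close> and the completed surface
  measure with \<open>surf_grad\<close>. \<open>X\<close> is kept apart from \<open>S\<close>
  because the bulk integral runs over the open domain, while the finite element functions live on
  its closure. In \<open>gradient\<close>, membership in the tangent span of the cell singles out
  one vector \<open>d\<close>.\<close>

locale measured_mesh = simplicial_mesh S \<T> + complete_measure M
  for S :: "'a::euclidean_space set" and \<T> and M :: "'a measure" +
  fixes X :: "'a set" and D :: "('a \<Rightarrow> real) \<Rightarrow> 'a \<Rightarrow> 'a"
  assumes borel_M: "sets borel \<subseteq> sets M" "space M = UNIV"
    and domain: "X \<in> sets borel" "\<Union>\<T> \<subseteq> X" "X \<subseteq> S" "emeasure M X < \<infinity>"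
    and skeleton_null: "X - \<Union>\<T> \<in> null_sets M"
    and cell_pos: "K \<in> \<T> \<Longrightarrow> emeasure M K > 0"
    and disjoint: "pairwise disjnt \<T>"
    and connected: "connected S" "S \<noteq> {}"
    and gradient: "u \<in> pw_affine S \<T> \<Longrightarrow> K \<in> \<T> \<Longrightarrow>
      \<exists>d. (\<forall>x\<in>K. D u x = d) \<and> d \<in> span {y - x |x y. x \<in> K \<and> y \<in> K} \<and> (\<forall>x\<in>K. \<forall>y\<in>K. u y - u x = d \<bullet> (y - x))"
begin

text \<open>Mass lumping: integrating the interpolant is a quadrature rule that sees only the vertex
  values.\<close>

definition mass :: "('a \<Rightarrow> real) \<Rightarrow> real" where
  "mass f = (LINT x:X|M. interp S \<T> f x)"

definition stiff :: "('a \<Rightarrow> real) \<Rightarrow> ('a \<Rightarrow> real) \<Rightarrow> real" where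
  "stiff u v = (LINT x:X|M. D u x \<bullet> D v x)"

lemma cell_ne: "K \<in> \<T> \<Longrightarrow> K \<noteq> {}"
  using cell_pos[of K] by auto

lemma cell_borel: "K \<in> \<T> \<Longrightarrow> K \<in> sets borel"
  using cell(3) rel_interior_borel by metis

lemma mesh_ne: "\<T> \<noteq> {}"
  using connected cover by auto

lemma mesh_vertices_ne: "mesh_vertices \<T> \<noteq> {}"
proof -
  obtain K where K: "K \<in> \<T>" using mesh_ne by blast
  have "closure K \<noteq> {}" using cell_ne[OF K] by simp
  then have "cell_vertices K \<noteq> {}" using cell(2)[OF K] by (metis convex_hull_empty)
  then show ?thesis using K by (auto simp: mesh_vertices_eq)
qed

lemma integrable_pw_linear:
  assumes "u \<in> pw_linear_space S \<T>"
  shows "integrable M (\<lambda>x. indicator X x *\<^sub>R u x)"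
proof -
  have cont: "continuous_on S u" and 0: "\<And>x. x \<notin> S \<Longrightarrow> u x = 0" using assms by (auto simp: pw_linear_space_def)
  have "(\<lambda>x. indicator S x *\<^sub>R u x) = u" by (rule ext) (use 0 in \<open>auto simp: indicator_def\<close>)
  moreover have "(\<lambda>x. indicator S x *\<^sub>R u x) \<in> borel_measurable borel"
    using compact_mesh cont by (intro borel_measurable_continuous_on_indicator) (auto intro: borel_compact)
  ultimately have "u \<in> borel_measurable borel" by simp
  moreover have "measurable borel borel \<subseteq> measurable M (borel :: real measure)"
    using borel_M by (intro measurable_mono) auto
  ultimately have u: "u \<in> borel_measurable M" by blast
  have "bounded (u ` S)" using compact_continuous_image[OF cont compact_mesh] compact_imp_bounded by blast
  then obtain B where "\<forall>x\<in>S. norm (u x) \<le> B" by (auto simp: bounded_iff)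
  then have "AE x in M. x \<in> X \<longrightarrow> norm (u x) \<le> B" using domain(3) by auto
  then show ?thesis
    using domain borel_M u by (intro integrableI_bounded_set_indicator[where B=B]) auto
qed

lemma mass_cong: "(\<And>x. x \<in> mesh_vertices \<T> \<Longrightarrow> f x = g x) \<Longrightarrow> mass f = mass g"
  unfolding mass_def using interp_cong by metis

lemma mass_add: "mass (\<lambda>x. f x + g x) = mass f + mass g"
  unfolding mass_def set_lebesgue_integral_def interp_add
  using integrable_pw_linear interp_spec(1) by (simp add: distrib_left)

lemma mass_cmult: "mass (\<lambda>x. c * f x) = c * mass f"
  unfolding mass_def set_lebesgue_integral_def interp_cmult
  by (simp add: mult.left_commute)

lemma mass_nonneg_integrand:
  assumes "\<And>x. x \<in> mesh_vertices \<T> \<Longrightarrow> f x \<ge> 0"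
  shows "0 \<le> indicator X x *\<^sub>R interp S \<T> f x"
  using pw_affine_nonneg[of "interp S \<T> f" x] interp_spec assms domain(3)
  by (auto simp: indicator_def pw_linear_space_eq)

lemma mass_nonneg: "(\<And>x. x \<in> mesh_vertices \<T> \<Longrightarrow> f x \<ge> 0) \<Longrightarrow> mass f \<ge> 0"
  unfolding mass_def set_lebesgue_integral_def
  by (intro Bochner_Integration.integral_nonneg mass_nonneg_integrand)

text \<open>A nonnegative interpolant with zero integral vanishes almost everywhere on
  \<open>X\<close>. A cell has positive measure, so it contains a zero, which is a relative interior
  point of the closed cell. A nonnegative affine function with such a zero vanishes on the whole
  closed cell, vertices included.\<close>

lemma mass_eq_0:
  assumes nn: "\<And>x. x \<in> mesh_vertices \<T> \<Longrightarrow> f x \<ge> 0" and 0: "mass f = 0" and v: "v \<in> mesh_vertices \<T>"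
  shows "f v = 0"
proof -
  define u where "u = interp S \<T> f"
  have u: "u \<in> pw_affine S \<T>" using interp_spec by (auto simp: u_def pw_linear_space_eq)
  have ae: "AE x in M. indicator X x *\<^sub>R u x = 0"
    using 0 integral_nonneg_eq_0_iff_AE[OF integrable_pw_linear[OF interp_spec(1)], of f] mass_nonneg_integrand[OF nn]
    by (simp add: mass_def set_lebesgue_integral_def u_def)
  obtain K where K: "K \<in> \<T>" "v \<in> cell_vertices K" using v unfolding mesh_vertices_eq by blast
  have "\<exists>x\<in>K. u x = 0"
  proof (rule ccontr)
    assume "\<not> (\<exists>x\<in>K. u x = 0)"
    then have nz: "indicator X x *\<^sub>R u x \<noteq> 0" if "x \<in> K" for x
      using that domain(2) K(1) by (auto simp: indicator_def)
    have "AE x in M. x \<notin> K" using ae by eventually_elim (use nz in blast)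
    then have "emeasure M K = 0"
      using cell_borel[OF K(1)] borel_M by (subst AE_iff_measurable[of _ _ "\<lambda>x. x \<notin> K", symmetric]) auto
    then show False using cell_pos[OF K(1)] by simp
  qed
  then obtain x where x: "x \<in> rel_interior (closure K)" "u x = 0" using cell(3)[OF K(1)] by auto
  obtain a b where ab: "\<And>x. x \<in> closure K \<Longrightarrow> u x = a \<bullet> x + b"
    by (rule pw_affine_closure[OF u K(1)], rule that)
  have vK: "v \<in> closure K" using K cell_vertices_subset by auto
  have "a \<bullet> v + b = 0"
  proof (rule affine_nonneg_rel_interior_zero[OF cell(5)[OF K(1)] _ x(1) _ vK])
    show "0 \<le> a \<bullet> y + b" if "y \<in> closure K" for y
      using pw_affine_nonneg[OF u, of y] ab[OF that] interp_spec(2) nn cell_subset(2)[OF K(1)] that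
      by (auto simp: u_def)
    show "a \<bullet> x + b = 0" using ab x rel_interior_subset by force
  qed
  then show ?thesis using ab[OF vK] interp_spec(2)[OF v] by (simp add: u_def)
qed

lemma mass_one_pos: "mass (\<lambda>_. 1) > 0"
  using mass_nonneg[of "\<lambda>_. 1"] mass_eq_0[of "\<lambda>_. 1"] mesh_vertices_ne by fastforce

section \<open>Cellwise gradients and the stiffness form\<close>

definition cell_grad :: "('a \<Rightarrow> real) \<Rightarrow> 'a set \<Rightarrow> 'a" where
  "cell_grad u K = D u (SOME x. x \<in> K)"

lemma cell_grad:
  assumes u: "u \<in> pw_affine S \<T>" and K: "K \<in> \<T>"
  shows "x \<in> K \<Longrightarrow> D u x = cell_grad u K" "cell_grad u K \<in> span {y - x |x y. x \<in> K \<and> y \<in> K}"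
    "x \<in> K \<Longrightarrow> y \<in> K \<Longrightarrow> u y - u x = cell_grad u K \<bullet> (y - x)"
proof -
  obtain d where d: "\<forall>x\<in>K. D u x = d" "d \<in> span {y - x |x y. x \<in> K \<and> y \<in> K}" "\<forall>x\<in>K. \<forall>y\<in>K. u y - u x = d \<bullet> (y - x)"
    using gradient[OF u K] by blast
  have "cell_grad u K = d" using d(1) cell_ne[OF K] by (simp add: cell_grad_def some_in_eq)
  with d show "x \<in> K \<Longrightarrow> D u x = cell_grad u K" "cell_grad u K \<in> span {y - x |x y. x \<in> K \<and> y \<in> K}"
    "x \<in> K \<Longrightarrow> y \<in> K \<Longrightarrow> u y - u x = cell_grad u K \<bullet> (y - x)" by auto
qed

lemma cell_grad_eqI:
  assumes u: "u \<in> pw_affine S \<T>" and K: "K \<in> \<T>" and d: "d \<in> span {y - x |x y. x \<in> K \<and> y \<in> K}"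
    and eq: "\<And>x y. x \<in> K \<Longrightarrow> y \<in> K \<Longrightarrow> u y - u x = d \<bullet> (y - x)"
  shows "cell_grad u K = d"
  using cell_grad(3)[OF u K] eq by (intro tangential_vector_unique[OF cell_grad(2)[OF u K] d]) force

lemma cell_grad_add:
  assumes "u \<in> pw_affine S \<T>" "v \<in> pw_affine S \<T>" "K \<in> \<T>"
  shows "cell_grad (\<lambda>x. u x + v x) K = cell_grad u K + cell_grad v K"
  using cell_grad(3)[OF assms(1,3)] cell_grad(3)[OF assms(2,3)]
  by (intro cell_grad_eqI fun_subspaceD fun_subspace_pw_affine assms span_add cell_grad(2))
    (force simp: inner_add_left)

lemma cell_grad_cmult:
  assumes "u \<in> pw_affine S \<T>" "K \<in> \<T>"
  shows "cell_grad (\<lambda>x. c * u x) K = c *\<^sub>R cell_grad u K"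
proof (intro cell_grad_eqI fun_subspaceD fun_subspace_pw_affine assms span_scale cell_grad(2))
  fix x y assume "x \<in> K" "y \<in> K"
  from cell_grad(3)[OF assms this] show "c * u y - c * u x = c *\<^sub>R cell_grad u K \<bullet> (y - x)"
    by (simp flip: right_diff_distrib)
qed

text \<open>Off the null skeleton the integrand is constant on each of finitely many disjoint cells.
  Linearity and semidefiniteness of the form are read off from this sum.\<close>

lemma stiff_eq:
  assumes u: "u \<in> pw_affine S \<T>" and v: "v \<in> pw_affine S \<T>"
  shows "stiff u v = (\<Sum>K\<in>\<T>. measure M K * (cell_grad u K \<bullet> cell_grad v K))"
proof -
  define g where "g x = (\<Sum>K\<in>\<T>. indicator K x * (cell_grad u K \<bullet> cell_grad v K))" for x
  have fin: "emeasure M K < \<infinity>" if "K \<in> \<T>" for K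
  proof -
    have "emeasure M K \<le> emeasure M X" using that domain borel_M by (intro emeasure_mono) auto
    then show ?thesis using domain(4) by simp
  qed
  have int: "integrable M (\<lambda>x. indicator K x * (cell_grad u K \<bullet> cell_grad v K))" if "K \<in> \<T>" for K
    using fin[OF that] cell_borel[OF that] borel_M by (intro integrable_mult_left integrable_real_indicator) auto
  then have g: "integrable M g" unfolding g_def by (rule Bochner_Integration.integrable_sum)
  have eq: "indicator X x *\<^sub>R (D u x \<bullet> D v x) = g x" if x: "x \<notin> X - \<Union>\<T>" for x
  proof (cases "x \<in> X")
    case True
    then obtain K where K: "K \<in> \<T>" "x \<in> K" using x by blast
    have "x \<notin> L" if "L \<in> \<T> - {K}" for L
      using disjoint that K by (auto simp: pairwise_def disjnt_def)
    then have "g x = indicator K x * (cell_grad u K \<bullet> cell_grad v K)"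
      unfolding g_def by (subst sum.remove[OF finite_mesh K(1)]) (simp add: sum.neutral)
    then show ?thesis using True K cell_grad(1)[OF u K] cell_grad(1)[OF v K] by simp
  next
    case False
    then have "x \<notin> K" if "K \<in> \<T>" for K using that domain(2) by blast
    then show ?thesis using False by (simp add: g_def)
  qed
  have ae: "AE x in M. indicator X x *\<^sub>R (D u x \<bullet> D v x) = g x"
    using AE_not_in[OF skeleton_null] by eventually_elim (rule eq)
  \<comment> \<open>Integrability is clear for \<open>g\<close>; completeness of the measure
    transfers its measurability to the original integrand.\<close>
  have "stiff u v = integral\<^sup>L M g"
    unfolding stiff_def set_lebesgue_integral_def
    by (intro integral_cong_AE borel_measurable_AE_eq[OF _ ae] borel_measurable_integrable[OF g] ae)
  also have "\<dots> = (\<Sum>K\<in>\<T>. measure M K * (cell_grad u K \<bullet> cell_grad v K))"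
    unfolding g_def using int cell_borel borel_M
    by (subst Bochner_Integration.integral_sum) (auto intro!: sum.cong)
  finally show ?thesis .
qed

lemma stiff_commute: "stiff u v = stiff v u"
  by (simp add: stiff_def inner_commute)

lemma linear_on_stiff: "u \<in> pw_affine S \<T> \<Longrightarrow> linear_on (pw_affine S \<T>) (stiff u)"
  unfolding linear_on_def using fun_subspaceD[OF fun_subspace_pw_affine[of S \<T>]]
  by (simp add: stiff_eq cell_grad_add cell_grad_cmult inner_add_right distrib_left sum.distrib sum_distrib_left mult.left_commute)

lemma stiff_nonneg: "u \<in> pw_affine S \<T> \<Longrightarrow> stiff u u \<ge> 0"
  by (auto simp: stiff_eq intro!: sum_nonneg)

lemma measure_cell_pos:
  assumes "K \<in> \<T>" shows "measure M K > 0"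
proof -
  have "emeasure M K \<le> emeasure M X" using assms domain borel_M by (intro emeasure_mono) auto
  then show ?thesis using cell_pos[OF assms] domain(4)
    by (simp add: measure_def enn2real_positive_iff order_le_less_trans)
qed

text \<open>Since cells have positive measure, every cell gradient vanishes and \<open>u\<close> is
  constant on each closed cell. A continuous function with finitely many values on a connected set
  is constant, which replaces an argument along chains of neighbouring cells.\<close>

lemma stiff_eq_0:
  assumes u: "u \<in> pw_affine S \<T>" and 0: "stiff u u = 0"
  obtains c where "\<And>x. x \<in> S \<Longrightarrow> u x = c"
proof -
  have z: "cell_grad u K = 0" if K: "K \<in> \<T>" for K
  proof -
    have "\<forall>K\<in>\<T>. measure M K * (cell_grad u K \<bullet> cell_grad u K) = 0"
      using 0 unfolding stiff_eq[OF u u] by (subst (asm) sum_nonneg_eq_0_iff[OF finite_mesh]) auto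
    then show ?thesis using measure_cell_pos K by force
  qed
  have "\<exists>c. \<forall>x\<in>closure K. u x = c" if K: "K \<in> \<T>" for K
  proof -
    obtain x where x: "x \<in> K" using cell_ne[OF K] by blast
    have "u y = u x" if "y \<in> K" for y using cell_grad(3)[OF u K x that] z[OF K] by simp
    moreover have "continuous_on (closure K) u"
      using u cell_subset(2)[OF K] by (auto simp: pw_affine_def elim: continuous_on_subset)
    ultimately have "u y = u x" if "y \<in> closure K" for y
      using continuous_constant_on_closure[of K u "u x" y] that by blast
    then show ?thesis by blast
  qed
  then obtain c where c: "\<And>K x. K \<in> \<T> \<Longrightarrow> x \<in> closure K \<Longrightarrow> u x = c K" by metis
  have "u ` S \<subseteq> c ` \<T>" unfolding cover[symmetric] using c by force
  then have "finite (u ` S)" using finite_mesh finite_surj by blast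
  then have "u constant_on S"
    using u connected(1) by (intro continuous_finite_range_constant) (auto simp: pw_affine_def)
  then show thesis using that by (auto simp: constant_on_def)
qed

section \<open>The lumped inner product\<close>

definition mass_form :: "('a \<Rightarrow> real) \<Rightarrow> ('a \<Rightarrow> real) \<Rightarrow> real" where
  "mass_form u v = mass (\<lambda>x. u x * v x)"

lemma mass_form_commute: "mass_form u v = mass_form v u"
  by (simp add: mass_form_def mult.commute)

lemma mass_form_add:
  "mass_form u (\<lambda>x. v x + w x) = mass_form u v + mass_form u w"
  "mass_form (\<lambda>x. v x + w x) u = mass_form v u + mass_form w u"
  by (simp_all add: mass_form_def distrib_left distrib_right mass_add)

lemma mass_form_cmult:
  "mass_form u (\<lambda>x. c * v x) = c * mass_form u v" "mass_form (\<lambda>x. c * v x) u = c * mass_form v u"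
  by (simp_all add: mass_form_def mass_cmult mult.assoc mult.left_commute[of _ c])

lemma mass_form_diff:
  "mass_form u (\<lambda>x. v x - w x) = mass_form u v - mass_form u w"
  "mass_form (\<lambda>x. v x - w x) u = mass_form v u - mass_form w u"
  using mass_form_add[of u v "\<lambda>x. - 1 * w x"] mass_form_add(2)[of v "\<lambda>x. - 1 * w x" u]
  unfolding mass_form_cmult by simp_all

lemma mass_form_cong:
  assumes "\<And>x. x \<in> S \<Longrightarrow> u x = u' x" "\<And>x. x \<in> S \<Longrightarrow> v x = v' x"
  shows "mass_form u v = mass_form u' v'"
  unfolding mass_form_def using assms mesh_vertices_subset by (intro mass_cong) auto

lemma mass_form_nonneg: "mass_form u u \<ge> 0"
  unfolding mass_form_def by (intro mass_nonneg) simp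

lemma mass_form_eq_0:
  assumes "u \<in> pw_affine S \<T>" "mass_form u u = 0" "x \<in> S"
  shows "u x = 0"
proof -
  have "u v = 0" if "v \<in> mesh_vertices \<T>" for v
    using mass_eq_0[of "\<lambda>x. u x * u x" v] assms(2) that by (simp add: mass_form_def)
  moreover have "(\<lambda>_. 0) \<in> pw_affine S \<T>" using fun_subspace_pw_affine[of S \<T>] by (simp add: fun_subspace_def)
  ultimately show ?thesis using pw_affine_unique[of u "\<lambda>_. 0" x] assms by simp
qed

lemma stiff_add:
  assumes "u \<in> pw_affine S \<T>" "v \<in> pw_affine S \<T>" "w \<in> pw_affine S \<T>"
  shows "stiff u (\<lambda>x. v x + w x) = stiff u v + stiff u w" "stiff (\<lambda>x. v x + w x) u = stiff v u + stiff w u"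
  using linear_onD(1)[OF linear_on_stiff[OF assms(1)] assms(2,3)] by (simp_all add: stiff_commute[of _ u])

lemma stiff_cmult:
  assumes "u \<in> pw_affine S \<T>" "v \<in> pw_affine S \<T>"
  shows "stiff u (\<lambda>x. c * v x) = c * stiff u v" "stiff (\<lambda>x. c * v x) u = c * stiff v u"
  using linear_onD(2)[OF linear_on_stiff[OF assms(1)] assms(2)] by (simp_all add: stiff_commute[of _ u])

text \<open>\<open>D\<close> is abstract and might depend on values off \<open>S\<close>; cell
  gradients, however, are determined by the increments inside the cells.\<close>

lemma stiff_cong:
  assumes u: "u \<in> pw_affine S \<T>" and v: "v \<in> pw_affine S \<T>" "v' \<in> pw_affine S \<T>"
    and eq: "\<And>x. x \<in> S \<Longrightarrow> v x = v' x"
  shows "stiff u v = stiff u v'"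
proof -
  have "cell_grad v K = cell_grad v' K" if K: "K \<in> \<T>" for K
  proof (rule cell_grad_eqI[OF v(1) K cell_grad(2)[OF v(2) K]])
    fix x y assume "x \<in> K" "y \<in> K"
    then show "v y - v x = cell_grad v' K \<bullet> (y - x)"
      using cell_grad(3)[OF v(2) K] eq cell_subset(1)[OF K] by (metis subsetD)
  qed
  then show ?thesis by (simp add: stiff_eq u v)
qed

lemma stiff_const:
  assumes u: "u \<in> pw_affine S \<T>" and v: "v \<in> pw_affine S \<T>" and c: "\<And>x. x \<in> S \<Longrightarrow> v x = c"
  shows "stiff u v = 0"
proof -
  have "cell_grad v K = 0" if K: "K \<in> \<T>" for K
    using c cell_subset(1)[OF K] by (intro cell_grad_eqI[OF v K]) (auto simp: span_zero)
  then show ?thesis by (simp add: stiff_eq u v)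
qed

end

section \<open>Geometry of the boundary mesh\<close>

lemma negligible_lowdim_affine:
  fixes A :: "'a::euclidean_space set"
  assumes "aff_dim A < DIM('a)"
  shows "negligible A"
proof -
  obtain a b where "a \<noteq> 0" "A \<subseteq> {x. a \<bullet> x = b}" using aff_lowdim_subset_hyperplane[OF assms] .
  then show ?thesis using negligible_hyperplane[of a b] negligible_subset by blast
qed

text \<open>The prism lies in the affine hull of \<open>A\<close> together with the single point
  \<open>a0 + \<nu>\<close>.\<close>

lemma aff_dim_prism_le: "aff_dim (prism \<nu> A) \<le> aff_dim A + 1"
proof (cases "A = {}")
  case True
  then show ?thesis by (simp add: prism_def)
next
  case False
  then obtain a0 where a0: "a0 \<in> A" by blast
  let ?H = "affine hull (insert (a0 + \<nu>) A)"
  have "prism \<nu> A \<subseteq> ?H"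
  proof
    fix x assume "x \<in> prism \<nu> A"
    then obtain a t where x: "x = a + t *\<^sub>R \<nu>" "a \<in> A" by (auto simp: prism_def)
    have "a + t *\<^sub>R ((a0 + \<nu>) - a0) \<in> ?H"
      using x(2) a0 by (intro mem_affine_3_minus affine_affine_hull) (auto intro: hull_inc)
    then show "x \<in> ?H" using x(1) by simp
  qed
  then have "aff_dim (prism \<nu> A) \<le> aff_dim ?H" by (rule aff_dim_subset)
  also have "\<dots> \<le> aff_dim A + 1" by (simp add: aff_dim_insert)
  finally show ?thesis .
qed

lemma simplicial_partition_cell:
  assumes "simplicial_partition k S h \<T>" "K \<in> \<T>"
  shows "k simplex closure K" "K = rel_interior (closure K)"
proof -
  obtain C where C: "k simplex C" "K = rel_interior C"
    using assms unfolding simplicial_partition_def by blast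
  have "convex C" "compact C"
    using simplex_imp_polytope[OF C(1)] polytope_imp_convex polytope_imp_compact by auto
  then have "closure K = C"
    by (simp add: C(2) convex_closure_rel_interior compact_imp_closed)
  with C show "k simplex closure K" "K = rel_interior (closure K)" by auto
qed

lemma simplicial_mesh_partition:
  assumes P: "simplicial_partition k S h \<T>"
    and faces: "\<And>K L. K \<in> \<T> \<Longrightarrow> L \<in> \<T> \<Longrightarrow> closure K \<inter> closure L face_of closure K"
  shows "simplicial_mesh S \<T>"
proof
  show "\<exists>C k. k simplex C \<and> K = rel_interior C" if "K \<in> \<T>" for K
    using P that unfolding simplicial_partition_def by blast
qed (use P faces in \<open>auto simp: simplicial_partition_def\<close>)

locale bulk_surface_mesh =
  fixes \<Omega> :: "'a::euclidean_space set" and \<T> \<G> :: "'a set set" and h :: real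
  assumes dom: "convex_polyhedral_domain \<Omega>" and dim: "DIM('a) \<ge> 2"
    and bulk_partition: "simplicial_partition (int DIM('a)) (closure \<Omega>) h \<T>"
    and conforming: "triangulation (closure ` \<T>)"
    and surf_partition: "simplicial_partition (int DIM('a) - 1) (frontier \<Omega>) h \<G>"
    and trace: "\<And>L. L \<in> \<G> \<Longrightarrow> \<exists>K\<in>\<T>. closure L = closure K \<inter> frontier \<Omega>"
begin

lemma domain: "open \<Omega>" "\<Omega> \<noteq> {}" "bounded \<Omega>" "convex \<Omega>" "polytope (closure \<Omega>)"
  using dom by (auto simp: convex_polyhedral_domain_def)

lemma rel_interior_closure_domain: "rel_interior (closure \<Omega>) = \<Omega>"
  using domain by (simp add: convex_rel_interior_closure rel_interior_open)

lemma frontier_eq: "frontier \<Omega> = rel_frontier (closure \<Omega>)"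
  using domain by (simp add: rel_frontier_def rel_interior_closure_domain frontier_def interior_open)

lemma compact_frontier: "compact (frontier \<Omega>)"
  using domain by (simp add: compact_frontier_bounded)

lemma frontier_facets: "frontier \<Omega> = \<Union> {\<Phi>. \<Phi> facet_of closure \<Omega>}"
  unfolding frontier_eq using domain by (intro rel_frontier_of_polyhedron polytope_imp_polyhedron)

sublocale bulk: simplicial_mesh "closure \<Omega>" \<T>
  by (rule simplicial_mesh_partition[OF bulk_partition])
    (use conforming in \<open>auto simp: triangulation_def\<close>)

section \<open>Boundary cells as faces of bulk cells\<close>

lemma aff_dim_surf_cell: "L \<in> \<G> \<Longrightarrow> aff_dim (closure L) = int DIM('a) - 1"
  using simplicial_partition_cell(1)[OF surf_partition] aff_dim_simplex by blast

lemma surf_cell: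
  assumes "L \<in> \<G>"
  shows "L = rel_interior (closure L)" "convex (closure L)" "compact (closure L)" "polytope (closure L)"
    "L \<noteq> {}" "closure L \<subseteq> frontier \<Omega>"
proof -
  show p: "polytope (closure L)"
    using simplicial_partition_cell(1)[OF surf_partition assms] simplex_imp_polytope by blast
  show "L = rel_interior (closure L)" by (rule simplicial_partition_cell(2)[OF surf_partition assms])
  show "convex (closure L)" "compact (closure L)" by (rule p[THEN polytope_imp_convex], rule p[THEN polytope_imp_compact])
  show "L \<noteq> {}" using aff_dim_surf_cell[OF assms] dim by auto
  show "closure L \<subseteq> frontier \<Omega>" using assms surf_partition by (auto simp: simplicial_partition_def)
qed

text \<open>A face that meets the relative interior of a subset contains all of it, so a facet of
  the domain through one point of \<open>L\<close> contains the closed cell. Equality of dimensions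
  then makes the affine hull of the cell the whole supporting hyperplane.\<close>

lemma surf_cell_facet:
  assumes L: "L \<in> \<G>"
  obtains \<Phi> \<nu> b where "\<Phi> facet_of closure \<Omega>" "\<nu> = outer_normal \<Omega> \<Phi>" "norm \<nu> = 1"
    "\<And>y. y \<in> closure \<Omega> \<Longrightarrow> \<nu> \<bullet> y \<le> b" "\<Phi> = closure \<Omega> \<inter> {x. \<nu> \<bullet> x = b}" "closure L \<subseteq> \<Phi>"
    "affine hull (closure L) = {x. \<nu> \<bullet> x = b}"
proof -
  obtain x where x: "x \<in> L" using surf_cell(5)[OF L] by blast
  then have "x \<in> frontier \<Omega>" using surf_cell(6)[OF L] closure_subset by blast
  then obtain \<Phi> where \<Phi>: "\<Phi> facet_of closure \<Omega>" "x \<in> \<Phi>" unfolding frontier_facets by blast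
  have sub: "closure L \<subseteq> \<Phi>"
  proof (rule subset_of_face_of)
    show "\<Phi> face_of closure \<Omega>" using \<Phi> by (simp add: facet_of_def)
    show "closure L \<subseteq> closure \<Omega>" using surf_cell(6)[OF L] frontier_def[of \<Omega>] by blast
    show "\<Phi> \<inter> rel_interior (closure L) \<noteq> {}" using \<Phi> x surf_cell(1)[OF L] by blast
  qed
  obtain b where b: "norm (outer_normal \<Omega> \<Phi>) = 1"
    "\<And>y. y \<in> closure \<Omega> \<Longrightarrow> outer_normal \<Omega> \<Phi> \<bullet> y \<le> b"
    "\<Phi> = closure \<Omega> \<inter> {x. outer_normal \<Omega> \<Phi> \<bullet> x = b}"
    by (rule outer_normal_facet[OF dom \<Phi>(1)], rule that)
  have "affine hull (closure L) = {x. outer_normal \<Omega> \<Phi> \<bullet> x = b}"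
  proof (rule affine_dim_equal)
    show "affine hull (closure L) \<subseteq> {x. outer_normal \<Omega> \<Phi> \<bullet> x = b}"
      using sub b(3) by (intro hull_minimal affine_hyperplane) blast
    have "outer_normal \<Omega> \<Phi> \<noteq> 0" using b(1) by auto
    then show "aff_dim (affine hull (closure L)) = aff_dim {x. outer_normal \<Omega> \<Phi> \<bullet> x = b}"
      using aff_dim_surf_cell[OF L] by (simp add: aff_dim_hyperplane)
  qed (use surf_cell(5)[OF L] in \<open>auto simp: affine_hyperplane\<close>)
  then show thesis using that[OF \<Phi>(1) refl b sub] by blast
qed

text \<open>The trace condition intersects a bulk cell with the whole boundary, which is not convex.
  Since the intersection lies in one facet of the domain, it equals the intersection with a single
  supporting hyperplane, and that is a face.\<close>

lemma surf_cell_face: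
  assumes L: "L \<in> \<G>"
  obtains K where "K \<in> \<T>" "closure L = closure K \<inter> frontier \<Omega>" "closure L face_of closure K"
proof -
  obtain K where K: "K \<in> \<T>" "closure L = closure K \<inter> frontier \<Omega>" using trace[OF L] by blast
  obtain \<Phi> \<nu> b where \<Phi>: "\<Phi> facet_of closure \<Omega>"
    "\<And>y. y \<in> closure \<Omega> \<Longrightarrow> \<nu> \<bullet> y \<le> b" "\<Phi> = closure \<Omega> \<inter> {x. \<nu> \<bullet> x = b}" "closure L \<subseteq> \<Phi>"
    by (rule surf_cell_facet[OF L], rule that)
  have sub: "closure K \<subseteq> closure \<Omega>" by (rule bulk.cell_subset(2)[OF K(1)])
  have "\<Phi> \<subseteq> frontier \<Omega>" using \<Phi>(1) frontier_facets by blast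
  then have "closure L = closure K \<inter> {x. \<nu> \<bullet> x = b}"
    using K(2) \<Phi>(3,4) sub by blast
  moreover have "closure K \<inter> {x. \<nu> \<bullet> x = b} face_of closure K"
    using sub \<Phi>(2) bulk.cell(5)[OF K(1)] by (intro face_of_Int_supporting_hyperplane_le) auto
  ultimately show thesis using that K by simp
qed

text \<open>Conformity is inherited from the bulk mesh: the intersection of two closed boundary
  cells is an intersection of faces of \<open>closure K1\<close>, hence a face of it that is
  contained in \<open>closure L1\<close>.\<close>

sublocale surf: simplicial_mesh "frontier \<Omega>" \<G>
proof (rule simplicial_mesh_partition[OF surf_partition])
  fix L1 L2 assume L: "L1 \<in> \<G>" "L2 \<in> \<G>"
  obtain K1 where K1: "K1 \<in> \<T>" "closure L1 = closure K1 \<inter> frontier \<Omega>" "closure L1 face_of closure K1"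
    by (rule surf_cell_face[OF L(1)], rule that)
  obtain K2 where K2: "K2 \<in> \<T>" "closure L2 = closure K2 \<inter> frontier \<Omega>"
    by (rule surf_cell_face[OF L(2)], rule that)
  have eq: "closure L1 \<inter> closure L2 = closure L1 \<inter> (closure K1 \<inter> closure K2)"
    using K1(2) K2(2) by blast
  have "closure L1 \<inter> (closure K1 \<inter> closure K2) face_of closure K1"
    using K1(3) bulk.face_cells[OF K1(1) K2(1)] by (rule face_of_Int)
  then show "closure L1 \<inter> closure L2 face_of closure L1"
    unfolding eq using K1(3) by (elim face_of_subset) (auto dest: face_of_imp_subset)
qed

text \<open>The common face meets the relative interior of \<open>closure L\<close>, so it is all of
  \<open>closure L\<close>. Thus \<open>closure L\<close> is a face of \<open>closure L'\<close> of
  the same dimension.\<close>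

lemma surf_cell_separated:
  assumes L: "L \<in> \<G>" and L': "L' \<in> \<G>" and x: "x \<in> L" "x \<in> closure L'"
  shows "L = L'"
proof -
  have f: "closure L \<inter> closure L' face_of closure L'"
    using surf.face_cells[OF L' L] by (simp add: Int_commute)
  have "closure L \<subseteq> closure L \<inter> closure L'"
  proof (rule subset_of_face_of[OF surf.face_cells[OF L L']])
    show "(closure L \<inter> closure L') \<inter> rel_interior (closure L) \<noteq> {}"
      using x surf_cell(1)[OF L] closure_subset by blast
  qed simp
  then have "closure L face_of closure L'" using f by (simp add: inf.absorb1)
  then have "closure L = closure L'"
    using face_of_aff_dim_lt[OF surf_cell(2)[OF L']] aff_dim_surf_cell L L' by force
  then show ?thesis using surf_cell(1) L L' by metis
qed

text \<open>The other closed cells form a closed set that avoids \<open>x\<close>, so near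
  \<open>x\<close> the boundary is the flat piece \<open>L\<close>. Derivatives within the boundary
  can therefore be computed on the cell.\<close>

lemma surf_cell_ball:
  assumes L: "L \<in> \<G>" and x: "x \<in> L"
  obtains e where "e > 0" "ball x e \<inter> affine hull (closure L) \<subseteq> L" "ball x e \<inter> frontier \<Omega> \<subseteq> L"
proof -
  obtain U where U: "open U" "L = affine hull (closure L) \<inter> U"
    using openin_rel_interior[of "closure L"] surf_cell(1)[OF L] by (metis openin_open)
  then obtain e1 where e1: "e1 > 0" "ball x e1 \<subseteq> U" using x open_contains_ball by blast
  then have e1': "ball x e1 \<inter> affine hull (closure L) \<subseteq> L" using U(2) by blast
  define R where "R = (\<Union>L'\<in>\<G> - {L}. closure L')"
  have "closed R" unfolding R_def using surf.finite_mesh by (intro closed_UN) auto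
  moreover have "x \<notin> R" using surf_cell_separated[OF L _ x] by (auto simp: R_def)
  ultimately obtain e2 where e2: "e2 > 0" "ball x e2 \<subseteq> - R"
    using open_contains_ball[of "- R"] by auto
  have "ball x (min e1 e2) \<inter> frontier \<Omega> \<subseteq> closure L"
  proof
    fix y assume y: "y \<in> ball x (min e1 e2) \<inter> frontier \<Omega>"
    then obtain L' where "L' \<in> \<G>" "y \<in> closure L'" using surf.cover by blast
    moreover have "y \<notin> R" using e2(2) y by auto
    ultimately show "y \<in> closure L" by (auto simp: R_def)
  qed
  then have "ball x (min e1 e2) \<inter> frontier \<Omega> \<subseteq> L"
    using e1' hull_subset[of "closure L" affine] by fastforce
  then show thesis using e1' e1(1) e2(1) by (intro that[of "min e1 e2"]) auto
qed

lemma trace_pw_affine: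
  assumes u: "u \<in> pw_affine (closure \<Omega>) \<T>"
  shows "u \<in> pw_affine (frontier \<Omega>) \<G>"
proof -
  have "\<exists>a b. \<forall>x\<in>L. u x = a \<bullet> x + b" if L: "L \<in> \<G>" for L
  proof -
    obtain K where K: "K \<in> \<T>" "closure L = closure K \<inter> frontier \<Omega>"
      by (rule surf_cell_face[OF L], rule that)
    obtain a b where ab: "\<And>x. x \<in> closure K \<Longrightarrow> u x = a \<bullet> x + b"
      by (rule bulk.pw_affine_closure[OF u K(1)], rule that)
    have "L \<subseteq> closure K" using K(2) closure_subset by blast
    then show ?thesis using ab by blast
  qed
  moreover have "continuous_on (frontier \<Omega>) u"
    using u by (auto simp: pw_affine_def frontier_def elim: continuous_on_subset)
  ultimately show ?thesis by (simp add: pw_affine_def)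
qed

lemma surf_vertices_subset: "mesh_vertices \<G> \<subseteq> mesh_vertices \<T>"
proof
  fix v assume "v \<in> mesh_vertices \<G>"
  then obtain L where L: "L \<in> \<G>" "v extreme_point_of closure L" by (auto simp: mesh_vertices_def)
  obtain K where K: "K \<in> \<T>" "closure L face_of closure K"
    by (rule surf_cell_face[OF L(1)], rule that)
  then show "v \<in> mesh_vertices \<T>"
    using extreme_point_of_face[OF K(2), of v] L(2) by (auto simp: mesh_vertices_def)
qed

lemma frontier_ne: "frontier \<Omega> \<noteq> {}"
  using domain frontier_eq_empty[of \<Omega>] by auto

text \<open>A bulk cell with a facet on the boundary touches the boundary in that facet only, hence its
  remaining vertex is interior.\<close>

lemma interior_vertex: "mesh_vertices \<T> - frontier \<Omega> \<noteq> {}"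
proof
  assume *: "mesh_vertices \<T> - frontier \<Omega> = {}"
  obtain L where L: "L \<in> \<G>" using frontier_ne surf.cover by blast
  obtain K where K: "K \<in> \<T>" "closure L = closure K \<inter> frontier \<Omega>"
    by (rule surf_cell_face[OF L], rule that)
  have "bulk.cell_vertices K \<subseteq> closure L"
    using * K bulk.cell_vertices_subset by (auto simp: bulk.mesh_vertices_eq)
  then have "closure K \<subseteq> closure L"
    unfolding bulk.cell(2)[OF K(1)] using surf_cell(2)[OF L] by (rule hull_minimal)
  then have "aff_dim (closure K) \<le> aff_dim (closure L)" by (rule aff_dim_subset)
  moreover have "aff_dim (closure K) = int DIM('a)"
    using simplicial_partition_cell(1)[OF bulk_partition K(1)] aff_dim_simplex by blast
  ultimately show False using aff_dim_surf_cell[OF L] by simp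
qed

text \<open>This is where the dimension bound enters: the boundary of an interval consists of two
  points. Connectedness is what turns a vanishing surface gradient into a constant.\<close>

lemma connected_frontier: "connected (frontier \<Omega>)"
proof -
  have "aff_dim (closure \<Omega>) = int DIM('a)" using domain by (simp add: aff_dim_open)
  then show ?thesis
    unfolding frontier_eq using domain dim by (intro connected_sphere_gen) auto
qed

end

section \<open>Gradients and measures of cells\<close>

lemma direction_in_span:
  fixes d :: "'a::real_vector"
  assumes "x \<in> K" "x + t *\<^sub>R d \<in> K" "t \<noteq> 0"
  shows "d \<in> span {y - x |x y. x \<in> K \<and> y \<in> K}"
proof -
  have "(x + t *\<^sub>R d) - x \<in> {y - x |x y. x \<in> K \<and> y \<in> K}" using assms by blast
  then have "(1 / t) *\<^sub>R ((x + t *\<^sub>R d) - x) \<in> span {y - x |x y. x \<in> K \<and> y \<in> K}"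
    by (intro span_scale span_base)
  then show ?thesis using assms(3) by simp
qed

lemma segment_in_ball:
  fixes v :: "'a::real_normed_vector"
  assumes "e > 0"
  obtains s where "s > 0" "\<And>t. \<bar>t\<bar> < s \<Longrightarrow> x + t *\<^sub>R v \<in> ball x e"
proof (rule that[of "e / (norm v + 1)"])
  show "e / (norm v + 1) > 0" using assms by (simp add: add_nonneg_pos)
  fix t :: real assume "\<bar>t\<bar> < e / (norm v + 1)"
  then have "\<bar>t\<bar> * (norm v + 1) < e" by (simp add: pos_less_divide_eq add_nonneg_pos)
  moreover have "\<bar>t\<bar> * norm v \<le> \<bar>t\<bar> * (norm v + 1)" by (simp add: mult_left_mono)
  ultimately show "x + t *\<^sub>R v \<in> ball x e" by (simp add: dist_norm)
qed

lemma grad_eqI: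
  assumes "GDERIV f x :> d"
  shows "grad f x = d"
  unfolding grad_def
proof (rule the_equality)
  show "GDERIV f x :> d" by (rule assms)
  fix d' assume "GDERIV f x :> d'"
  then have "(\<lambda>v. v \<bullet> d') = (\<lambda>v. v \<bullet> d)"
    using assms by (auto simp: gderiv_def intro: has_derivative_unique)
  then have "(d' - d) \<bullet> d' = (d' - d) \<bullet> d" by metis
  then have "(d' - d) \<bullet> (d' - d) = 0" by (simp add: inner_diff_right)
  then show "d' = d" by simp
qed

context bulk_surface_mesh
begin

lemma bulk_cell:
  assumes "K \<in> \<T>"
  shows "open K" "K \<noteq> {}" "K \<subseteq> \<Omega>" "closure K - K = frontier (closure K)"
proof -
  have d: "aff_dim (closure K) = int DIM('a)"
    using simplicial_partition_cell(1)[OF bulk_partition assms] aff_dim_simplex by blast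
  have K: "K = interior (closure K)"
    using bulk.cell(3)[OF assms] interior_rel_interior[OF d] by simp
  show o: "open K" by (subst K) simp
  show "K \<noteq> {}" using d by auto
  have "K \<subseteq> interior (closure \<Omega>)"
    using o bulk.cell_subset(1)[OF assms] by (rule interior_maximal[rotated])
  then show "K \<subseteq> \<Omega>" using domain by (simp add: convex_interior_closure interior_open)
  show "closure K - K = frontier (closure K)" using K by (simp add: frontier_def)
qed

lemma bulk_gradient:
  assumes u: "u \<in> pw_affine (closure \<Omega>) \<T>" and K: "K \<in> \<T>"
  shows "\<exists>d. (\<forall>x\<in>K. grad u x = d) \<and> d \<in> span {y - x |x y. x \<in> K \<and> y \<in> K} \<and>
    (\<forall>x\<in>K. \<forall>y\<in>K. u y - u x = d \<bullet> (y - x))"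
proof -
  obtain a b where ab: "\<And>x. x \<in> K \<Longrightarrow> u x = a \<bullet> x + b"
    using u K unfolding pw_affine_def by blast
  have "grad u x = a" if x: "x \<in> K" for x
  proof (rule grad_eqI)
    have "((\<lambda>x. a \<bullet> x + b) has_derivative (\<lambda>v. v \<bullet> a)) (at x)"
      by (auto intro!: derivative_eq_intros simp: inner_commute)
    then have "(u has_derivative (\<lambda>v. v \<bullet> a)) (at x)"
      by (rule has_derivative_transform_within_open[OF _ bulk_cell(1)[OF K] x]) (simp add: ab)
    then show "GDERIV u x :> a" by (simp add: gderiv_def)
  qed
  moreover have "a \<in> span {y - x |x y. x \<in> K \<and> y \<in> K}"
  proof -
    obtain x where x: "x \<in> K" using bulk_cell(2)[OF K] by blast
    obtain e where e: "e > 0" "ball x e \<subseteq> K" using bulk_cell(1)[OF K] x open_contains_ball by blast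
    obtain s where s: "s > 0" "\<And>t. \<bar>t\<bar> < s \<Longrightarrow> x + t *\<^sub>R a \<in> ball x e"
      by (rule segment_in_ball[OF e(1), where x=x and v=a], rule that)
    show ?thesis
      by (rule direction_in_span[OF x, of "s / 2"]) (use s e(2) in auto)
  qed
  ultimately show ?thesis using ab by (intro exI[of _ a]) (auto simp: inner_diff_right)
qed

sublocale bulk: measured_mesh "closure \<Omega>" \<T> lebesgue \<Omega> grad
proof
  show "\<Omega> \<in> sets borel" using domain by simp
  show "emeasure lebesgue \<Omega> < \<infinity>" using emeasure_bounded_finite[OF domain(3)] domain(1) by simp
  show "\<Union> \<T> \<subseteq> \<Omega>" using bulk_cell(3) by blast
  \<comment> \<open>The skeleton is covered by the boundaries of finitely many convex sets.\<close>
  have "negligible (\<Union>K\<in>\<T>. closure K - K)"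
    using bulk.finite_mesh bulk.cell(5) bulk_cell(4)
    by (intro negligible_Union) (auto simp: negligible_convex_frontier)
  moreover have "\<Omega> - \<Union>\<T> \<subseteq> (\<Union>K\<in>\<T>. closure K - K)"
    using bulk.cover closure_subset[of \<Omega>] by blast
  ultimately show "\<Omega> - \<Union> \<T> \<in> null_sets lebesgue"
    using negligible_subset negligible_iff_null_sets by metis
  show "0 < emeasure lebesgue K" if "K \<in> \<T>" for K
    using open_not_negligible[OF bulk_cell(1,2)[OF that]] negligible_iff_emeasure0[of K] bulk_cell(1)[OF that]
    by (simp add: zero_less_iff_neq_zero)
  show "pairwise disjnt \<T>" using bulk_partition by (simp add: simplicial_partition_def)
  show "connected (closure \<Omega>)" using domain by (simp add: convex_connected)
qed (use domain closure_subset bulk_gradient in auto)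

section \<open>Tangential derivatives on the boundary\<close>

lemma surf_tangent:
  assumes L: "L \<in> \<G>" and hull: "affine hull (closure L) = {x. \<nu> \<bullet> x = b}" and x: "x \<in> L" and v: "\<nu> \<bullet> v = 0"
  obtains s where "s > 0" "\<And>t. \<bar>t\<bar> < s \<Longrightarrow> x + t *\<^sub>R v \<in> L"
proof -
  obtain e where e: "e > 0" "ball x e \<inter> affine hull (closure L) \<subseteq> L"
    by (rule surf_cell_ball[OF L x], rule that)
  obtain s where s: "s > 0" "\<And>t. \<bar>t\<bar> < s \<Longrightarrow> x + t *\<^sub>R v \<in> ball x e"
    by (rule segment_in_ball[OF e(1), where x=x and v=v], rule that)
  have "x \<in> affine hull (closure L)" using x closure_subset[of L] by (intro hull_inc) blast
  then have "x + t *\<^sub>R v \<in> affine hull (closure L)" for t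
    using v unfolding hull by (simp add: inner_add_right)
  then show thesis using s e(2) by (intro that[of s]) blast+
qed

text \<open>From a point of \<open>L\<close> one can move both ways along a tangent direction
  without leaving the closed domain. A competing normal hence has no tangential part and is
  \<open>\<nu>\<close> or its negative; the latter would squeeze the open set \<Omega> into a
  hyperplane.\<close>

lemma outer_normal_point:
  assumes L: "L \<in> \<G>" and hull: "affine hull (closure L) = {x. \<nu> \<bullet> x = b}" and x: "x \<in> L"
    and n1: "norm \<nu> = 1" and le: "\<And>y. y \<in> closure \<Omega> \<Longrightarrow> \<nu> \<bullet> y \<le> b"
  shows "outer_normal \<Omega> {x} = \<nu>"
  unfolding outer_normal_def
proof (rule the_equality)
  have xb: "\<nu> \<bullet> x = b" using hull_inc[of x "closure L" affine] x closure_subset[of L] hull by auto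
  show "norm \<nu> = 1 \<and> (\<forall>x\<in>{x}. \<forall>y\<in>\<Omega>. \<nu> \<bullet> (y - x) \<le> 0)"
    using n1 le closure_subset[of \<Omega>] xb by (auto simp: inner_diff_right)
  have nn: "\<nu> \<bullet> \<nu> = 1" using n1 by (simp add: norm_eq_1)
  fix \<nu>' assume asm: "norm \<nu>' = 1 \<and> (\<forall>x\<in>{x}. \<forall>y\<in>\<Omega>. \<nu>' \<bullet> (y - x) \<le> 0)"
  have cl: "\<nu>' \<bullet> y \<le> \<nu>' \<bullet> x" if "y \<in> closure \<Omega>" for y
  proof -
    have "closure \<Omega> \<subseteq> {y. \<nu>' \<bullet> y \<le> \<nu>' \<bullet> x}"
      using asm by (intro closure_minimal closed_halfspace_le) (auto simp: inner_diff_right)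
    then show ?thesis using that by auto
  qed
  define w where "w = \<nu>' - (\<nu> \<bullet> \<nu>') *\<^sub>R \<nu>"
  have w0: "\<nu> \<bullet> w = 0" by (simp add: w_def inner_diff_right nn)
  obtain s where s: "s > 0" "\<And>t. \<bar>t\<bar> < s \<Longrightarrow> x + t *\<^sub>R w \<in> L"
    by (rule surf_tangent[OF L hull x w0], rule that)
  have LO: "L \<subseteq> closure \<Omega>"
    using surf_cell(6)[OF L] closure_subset[of L] frontier_def[of \<Omega>] by blast
  have "\<nu>' \<bullet> (x + t *\<^sub>R w) \<le> \<nu>' \<bullet> x" if "\<bar>t\<bar> < s" for t using s(2)[OF that] LO cl by blast
  from this[of "s/2"] this[of "-(s/2)"] have "(s/2) * (\<nu>' \<bullet> w) \<le> 0" "(s/2) * (\<nu>' \<bullet> w) \<ge> 0"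
    using s(1) by (simp_all add: inner_add_right inner_diff_right)
  then have "\<nu>' \<bullet> w = 0" using s(1) by (simp add: mult_le_0_iff zero_le_mult_iff)
  with w0 have "w \<bullet> w = 0" by (subst (1) w_def) (simp add: inner_diff_left)
  then have \<nu>': "\<nu>' = (\<nu> \<bullet> \<nu>') *\<^sub>R \<nu>" by (simp add: w_def)
  define t where "t = \<nu> \<bullet> \<nu>'"
  have "\<bar>t\<bar> = 1" using \<nu>' asm n1 by (metis norm_scaleR mult.right_neutral t_def)
  moreover have "t \<noteq> -1"
  proof
    assume "t = -1"
    then have m: "\<nu>' = - \<nu>" using \<nu>' by (simp add: t_def)
    have "\<Omega> \<subseteq> {x. \<nu> \<bullet> x = b}"
    proof
      fix y assume "y \<in> \<Omega>"
      then have "y \<in> closure \<Omega>" using closure_subset by auto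
      then show "y \<in> {x. \<nu> \<bullet> x = b}" using cl[of y] le[of y] xb m by auto
    qed
    then have "interior {x. \<nu> \<bullet> x = b} \<noteq> {}" using domain by (metis interior_maximal subset_empty)
    moreover have "\<nu> \<noteq> 0" using n1 by auto
    ultimately show False by (simp add: interior_hyperplane)
  qed
  ultimately have "t = 1" by linarith
  then show "\<nu>' = \<nu>" using \<nu>' by (simp add: t_def)
qed

lemma surf_gradient:
  assumes u: "u \<in> pw_affine (frontier \<Omega>) \<G>" and L: "L \<in> \<G>"
  shows "\<exists>d. (\<forall>x\<in>L. surf_grad \<Omega> u x = d) \<and> d \<in> span {y - x |x y. x \<in> L \<and> y \<in> L} \<and>
    (\<forall>x\<in>L. \<forall>y\<in>L. u y - u x = d \<bullet> (y - x))"
proof -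
  obtain a b where ab: "\<And>x. x \<in> L \<Longrightarrow> u x = a \<bullet> x + b"
    using u L unfolding pw_affine_def by blast
  obtain \<nu> c where \<nu>: "norm \<nu> = 1" "\<And>y. y \<in> closure \<Omega> \<Longrightarrow> \<nu> \<bullet> y \<le> c"
    "affine hull (closure L) = {x. \<nu> \<bullet> x = c}"
    by (rule surf_cell_facet[OF L], rule that)
  have nn: "\<nu> \<bullet> \<nu> = 1" using \<nu>(1) by (simp add: norm_eq_1)
  have Lc: "\<nu> \<bullet> x = c" if "x \<in> L" for x
    using hull_inc[of x "closure L" affine] that closure_subset[of L] \<nu>(3) by auto
  \<comment> \<open>On the cell, \<open>u\<close> fixes the slope \<open>a\<close> only up to
    multiples of \<open>\<nu>\<close>. The tangential projection is the representative that
    \<open>surf_grad\<close> asks for.\<close>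
  define d where "d = a - (a \<bullet> \<nu>) *\<^sub>R \<nu>"
  have d\<nu>: "d \<bullet> \<nu> = 0" by (simp add: d_def inner_diff_left nn)
  have eq: "u y - u x = d \<bullet> (y - x)" if "x \<in> L" "y \<in> L" for x y
    using ab[OF that(1)] ab[OF that(2)] Lc[OF that(1)] Lc[OF that(2)]
    by (simp add: d_def inner_diff_left inner_diff_right)
  have normal: "outer_normal \<Omega> {x} = \<nu>" if "x \<in> L" for x
    by (rule outer_normal_point[OF L \<nu>(3) that \<nu>(1)]) (rule \<nu>(2))
  have "surf_grad \<Omega> u x = d" if x: "x \<in> L" for x
    unfolding surf_grad_def normal[OF x]
  proof (rule the_equality)
    obtain e where e: "e > 0" "ball x e \<inter> frontier \<Omega> \<subseteq> L"
      by (rule surf_cell_ball[OF L x], rule that)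
    have xF: "x \<in> frontier \<Omega>" using surf.cell_subset(1)[OF L] x by blast
    have "((\<lambda>y. u x + d \<bullet> (y - x)) has_derivative (\<lambda>v. v \<bullet> d)) (at x within frontier \<Omega>)"
      by (auto intro!: derivative_eq_intros simp: inner_commute)
    moreover have "u x + d \<bullet> (y - x) = u y" if "y \<in> frontier \<Omega>" "dist y x < e" for y
      using that e(2) eq[OF x, of y] by (force simp: dist_commute)
    ultimately have der: "(u has_derivative (\<lambda>v. v \<bullet> d)) (at x within frontier \<Omega>)"
      by (rule has_derivative_transform_within[OF _ e(1) xF])
    then show "d \<bullet> \<nu> = 0 \<and> (u has_derivative (\<lambda>v. v \<bullet> d)) (at x within frontier \<Omega>)"
      using d\<nu> by blast
    fix d' assume d': "d' \<bullet> \<nu> = 0 \<and> (u has_derivative (\<lambda>v. v \<bullet> d')) (at x within frontier \<Omega>)"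
    \<comment> \<open>A derivative within the boundary is not unique as a linear map on the whole
      space, since the boundary has no extent in the normal direction at \<open>x\<close>. The
      candidates are compared along the tangent line with direction \<open>d' - d\<close>, where the
      one-dimensional derivative is unique.\<close>
    define w where "w = d' - d"
    have w: "\<nu> \<bullet> w = 0" using d' d\<nu> by (simp add: w_def inner_diff_right inner_commute)
    obtain s where s: "s > 0" "\<And>t. \<bar>t\<bar> < s \<Longrightarrow> x + t *\<^sub>R w \<in> L"
      by (rule surf_tangent[OF L \<nu>(3) x w], rule that)
    have along: "((\<lambda>t. u (x + t *\<^sub>R w)) has_derivative (\<lambda>t. (t *\<^sub>R w) \<bullet> p)) (at 0)"
      if p: "(u has_derivative (\<lambda>v. v \<bullet> p)) (at x within frontier \<Omega>)" for p
    proof -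
      let ?I = "{-s<..<s}"
      have line: "((\<lambda>t. x + t *\<^sub>R w) has_derivative (\<lambda>t. t *\<^sub>R w)) (at 0 within ?I)"
        by (auto intro!: derivative_eq_intros)
      have "(\<lambda>t. x + t *\<^sub>R w) ` ?I \<subseteq> frontier \<Omega>"
        using s(2) surf.cell_subset(1)[OF L] by (force simp: abs_less_iff)
      then have "(u has_derivative (\<lambda>v. v \<bullet> p)) (at (x + 0 *\<^sub>R w) within (\<lambda>t. x + t *\<^sub>R w) ` ?I)"
        using has_derivative_subset[OF p] by simp
      from has_derivative_in_compose[OF line this] show ?thesis
        using s(1) by (simp add: at_within_open[of 0 ?I])
    qed
    have "(\<lambda>t. (t *\<^sub>R w) \<bullet> d') = (\<lambda>t. (t *\<^sub>R w) \<bullet> d)"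
      using along[OF conjunct2[OF d']] along[OF der] by (rule has_derivative_unique)
    then have "(1 *\<^sub>R w) \<bullet> d' = (1 *\<^sub>R w) \<bullet> d" by metis
    then have "w \<bullet> w = 0" by (simp add: w_def inner_diff_right)
    then show "d' = d" by (simp add: w_def)
  qed
  moreover have "d \<in> span {y - x |x y. x \<in> L \<and> y \<in> L}"
  proof -
    obtain x where x: "x \<in> L" using surf_cell(5)[OF L] by blast
    obtain s where s: "s > 0" "\<And>t. \<bar>t\<bar> < s \<Longrightarrow> x + t *\<^sub>R d \<in> L"
      by (rule surf_tangent[OF L \<nu>(3) x d\<nu>[unfolded inner_commute[of d]]], rule that)
    show ?thesis by (rule direction_in_span[OF x, of "s / 2"]) (use s in auto)
  qed
  ultimately show ?thesis using eq by (intro exI[of _ d] conjI ballI) simp_all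
qed

section \<open>Surface measure of boundary cells\<close>

abbreviation "surf_meas \<equiv> completion (surface_measure \<Omega>)"

lemma sets_surface_measure: "sets (surface_measure \<Omega>) = sets borel" "space (surface_measure \<Omega>) = UNIV"
  using sets.sigma_sets_eq[of "borel :: 'a measure"] by (simp_all add: surface_measure_def)

lemma finite_facets: "finite {\<Phi>. \<Phi> facet_of closure \<Omega>}"
  using domain by (simp add: finite_polytope_facets)

lemma surface_measure_finite: "emeasure (surface_measure \<Omega>) (frontier \<Omega>) < \<infinity>"
proof -
  have "emeasure lborel (prism \<nu> (frontier \<Omega> \<inter> \<Phi>)) < \<infinity>" for \<nu> \<Phi>
  proof (rule emeasure_bounded_finite)
    have "prism \<nu> (frontier \<Omega> \<inter> \<Phi>) \<subseteq> (\<lambda>p. fst p + snd p *\<^sub>R \<nu>) ` (frontier \<Omega> \<times> {0..1})"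
      by (force simp: prism_def)
    moreover have "compact ((\<lambda>p. fst p + snd p *\<^sub>R \<nu>) ` (frontier \<Omega> \<times> {0..1::real}))"
      using compact_frontier by (intro compact_continuous_image compact_Times continuous_intros) auto
    ultimately show "bounded (prism \<nu> (frontier \<Omega> \<inter> \<Phi>))"
      using compact_imp_bounded bounded_subset by blast
  qed
  then show ?thesis
    using finite_facets by (subst emeasure_surface_measure[OF dom]) (auto simp: less_top)
qed

text \<open>The prism over such a set still has dimension below that of the space, so it lies in a
  hyperplane.\<close>

lemma surface_measure_lowdim:
  assumes "A \<in> sets borel" "aff_dim A < int DIM('a) - 1"
  shows "A \<in> null_sets (surface_measure \<Omega>)"
proof -
  have "emeasure lborel (prism \<nu> (A \<inter> \<Phi>)) = 0" for \<nu> \<Phi>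
  \<comment> \<open>Here \<open>\<nu>\<close> and \<open>\<Phi>\<close> are arbitrary, so the prism
    may fail to be measurable; \<open>emeasure\<close> is then 0 by convention.\<close>
  proof (cases "prism \<nu> (A \<inter> \<Phi>) \<in> sets lborel")
    case True
    have "aff_dim (prism \<nu> (A \<inter> \<Phi>)) \<le> aff_dim A + 1"
      using aff_dim_prism_le[of \<nu> "A \<inter> \<Phi>"] aff_dim_subset[of "A \<inter> \<Phi>" A] by auto
    then have "negligible (prism \<nu> (A \<inter> \<Phi>))" using assms(2) by (intro negligible_lowdim_affine) auto
    then show ?thesis using True by (simp add: negligible_iff_null_sets null_sets_def)
  qed (simp add: emeasure_notin_sets)
  then show ?thesis
    using assms(1) by (auto simp: null_sets_def sets_surface_measure emeasure_surface_measure[OF dom])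
qed

lemma surf_cell_boundary_null:
  assumes L: "L \<in> \<G>"
  shows "closure L - L \<in> null_sets (surface_measure \<Omega>)"
proof -
  have "rel_frontier (closure L) = \<Union> {F. F facet_of closure L}"
    using surf_cell(4)[OF L] by (intro rel_frontier_of_polyhedron polytope_imp_polyhedron)
  then have eq: "closure L - L = \<Union> {F. F facet_of closure L}"
    using surf_cell(1)[OF L] by (simp add: rel_frontier_def)
  have "F \<in> null_sets (surface_measure \<Omega>)" if "F facet_of closure L" for F
  proof (rule surface_measure_lowdim)
    have "polytope F" using that surf_cell(4)[OF L] face_of_polytope_polytope facet_of_imp_face_of by blast
    then show "F \<in> sets borel" by (intro borel_closed polytope_imp_closed)
    show "aff_dim F < int DIM('a) - 1" using that aff_dim_surf_cell[OF L] by (simp add: facet_of_def)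
  qed
  then show ?thesis
    unfolding eq using finite_polytope_facets[OF surf_cell(4)[OF L]]
    by (intro null_sets.finite_Union) auto
qed

text \<open>One summand of the surface measure suffices: the prism over the closed cell contains a
  nonempty open set. The closed cell is used because its prism is compact, hence measurable; passing
  to \<open>L\<close> removes only a null set.\<close>

lemma surface_measure_cell_pos:
  assumes L: "L \<in> \<G>"
  shows "emeasure (surface_measure \<Omega>) L > 0"
proof -
  obtain \<Phi> \<nu> b where \<Phi>: "\<Phi> facet_of closure \<Omega>" and \<nu>: "\<nu> = outer_normal \<Omega> \<Phi>" and n1: "norm \<nu> = 1"
    and sub: "closure L \<subseteq> \<Phi>" and hull: "affine hull (closure L) = {x. \<nu> \<bullet> x = b}"
    by (rule surf_cell_facet[OF L], rule that)
  have nn: "\<nu> \<bullet> \<nu> = 1" using n1 by (simp add: norm_eq_1)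
  obtain x where x: "x \<in> L" using surf_cell(5)[OF L] by blast
  have xb: "\<nu> \<bullet> x = b" using hull_inc[of x "closure L" affine] x closure_subset[of L] hull by auto
  obtain e where e: "e > 0" "ball x e \<inter> affine hull (closure L) \<subseteq> L"
    by (rule surf_cell_ball[OF L x], rule that)
  \<comment> \<open>\<open>f\<close> is the orthogonal projection onto the hyperplane of the facet.
    \<open>W\<close> consists of the points above a small disc in the cell, at height strictly
    between 0 and 1.\<close>
  define f where "f y = y - (\<nu> \<bullet> y - b) *\<^sub>R \<nu>" for y
  define W where "W = f -` ball x e \<inter> {y. 0 < \<nu> \<bullet> y - b} \<inter> {y. \<nu> \<bullet> y - b < 1}"
  have cf: "continuous_on UNIV f" unfolding f_def by (intro continuous_intros)
  have oW: "open W" unfolding W_def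
    by (intro open_Int open_vimage cf open_ball open_Collect_less continuous_intros)
  have "f (x + (1/2) *\<^sub>R \<nu>) = x" by (simp add: f_def inner_add_right nn xb)
  then have "x + (1/2) *\<^sub>R \<nu> \<in> W" using e(1) by (simp add: W_def inner_add_right nn xb)
  then have Wne: "W \<noteq> {}" by blast
  let ?P = "prism \<nu> (closure L \<inter> \<Phi>)"
  have WP: "W \<subseteq> ?P"
  proof
    fix y assume y: "y \<in> W"
    have "\<nu> \<bullet> f y = b" by (simp add: f_def inner_diff_right nn)
    then have "f y \<in> L" using e(2) y hull by (auto simp: W_def)
    then have "f y \<in> closure L \<inter> \<Phi>" using sub closure_subset[of L] by blast
    then show "y \<in> ?P"
      unfolding prism_def using y
      by (auto intro!: exI[of _ "f y"] exI[of _ "\<nu> \<bullet> y - b"] simp: f_def W_def)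
  qed
  have "?P = (\<lambda>p. fst p + snd p *\<^sub>R \<nu>) ` (closure L \<times> {0..1})"
    using sub by (force simp: prism_def)
  moreover have "compact ((\<lambda>p. fst p + snd p *\<^sub>R \<nu>) ` (closure L \<times> {0..1::real}))"
    by (intro compact_continuous_image compact_Times surf_cell(3)[OF L] continuous_intros compact_Icc)
  ultimately have "compact ?P" by simp
  then have Pm: "?P \<in> sets lborel" by (simp add: borel_compact)
  have "emeasure lborel W \<le> emeasure lborel ?P" using WP Pm by (rule emeasure_mono)
  moreover have "emeasure lborel W > 0"
    using open_not_negligible[OF oW Wne] negligible_iff_emeasure0[of W] oW
    by (simp add: zero_less_iff_neq_zero)
  ultimately have "emeasure lborel ?P > 0" by simp
  then have "emeasure (surface_measure \<Omega>) (closure L) > 0"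
    using finite_facets \<Phi> \<nu>
    by (subst emeasure_surface_measure[OF dom]) (auto simp: zero_less_iff_neq_zero)
  moreover have "emeasure (surface_measure \<Omega>) (closure L) = emeasure (surface_measure \<Omega>) L"
  proof -
    have "emeasure (surface_measure \<Omega>) (L \<union> (closure L - L)) = emeasure (surface_measure \<Omega>) L"
      using surf_cell_boundary_null[OF L] rel_interior_borel[of "closure L"] surf_cell(1)[OF L]
      by (intro emeasure_Un_null_set) (auto simp: sets_surface_measure)
    then show ?thesis using closure_subset[of L] by (simp add: Un_absorb1)
  qed
  ultimately show ?thesis by simp
qed

sublocale surf: measured_mesh "frontier \<Omega>" \<G> surf_meas "frontier \<Omega>" "surf_grad \<Omega>"
proof
  have bor: "L \<in> sets borel" if "L \<in> \<G>" for L
    using rel_interior_borel[of "closure L"] surf_cell(1)[OF that] by simp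
  show "sets borel \<subseteq> sets surf_meas" using sets_surface_measure by auto
  show "space surf_meas = UNIV" using sets_surface_measure by simp
  show "frontier \<Omega> \<in> sets borel" using compact_frontier by (rule borel_compact)
  then show "emeasure surf_meas (frontier \<Omega>) < \<infinity>"
    using surface_measure_finite sets_surface_measure by simp
  show "\<Union> \<G> \<subseteq> frontier \<Omega>" using surf.cell_subset(1) by blast
  have "(\<Union>L\<in>\<G>. closure L - L) \<in> null_sets (surface_measure \<Omega>)"
    using surf.finite_mesh surf_cell_boundary_null by (intro null_sets.finite_UN) auto
  moreover have "frontier \<Omega> - \<Union>\<G> \<subseteq> (\<Union>L\<in>\<G>. closure L - L)" using surf.cover by blast
  moreover have "frontier \<Omega> - \<Union>\<G> \<in> sets (surface_measure \<Omega>)"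
    unfolding sets_surface_measure using bor surf.finite_mesh \<open>frontier \<Omega> \<in> sets borel\<close>
    by (intro sets.Diff sets.finite_Union) auto
  ultimately show "frontier \<Omega> - \<Union> \<G> \<in> null_sets surf_meas"
    using null_sets_subset null_sets_completionI by blast
  show "0 < emeasure surf_meas L" if "L \<in> \<G>" for L
    using surface_measure_cell_pos[OF that] bor[OF that] sets_surface_measure by simp
  show "pairwise disjnt \<G>" using surf_partition by (simp add: simplicial_partition_def)
qed (use connected_frontier frontier_ne surf_gradient in auto)

end

section \<open>The linear system\<close>

text \<open>\<open>a\<close> and \<open>b\<close> stand for the two coefficients depending on \<xi>;
  \<open>a + b = 1\<close> makes \<open>b\<close> positive when \<open>a\<close> vanishes.
  \<open>p\<close> and \<open>q\<close> weight the rank one terms left by eliminating the scalar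
  unknowns, and \<open>F0\<close>, \<open>G0\<close> stand for the derivatives of the potentials at
  the old time level.\<close>

locale linear_scheme = bulk_surface_mesh \<Omega> \<T> \<G> h
  for \<Omega> :: "'a::euclidean_space set" and \<T> \<G> h +
  fixes \<beta> \<tau> a b p q :: real and F0 G0 :: "'a \<Rightarrow> real"
  assumes pos: "\<beta> > 0" "\<tau> > 0" and coeffs: "a \<ge> 0" "b \<ge> 0" "a + b = 1" and pq: "p \<ge> 0" "q \<ge> 0"
begin

abbreviation "U \<equiv> bulk_space \<Omega> \<T>"
abbreviation "V \<equiv> surf_space \<Omega> \<G>"

definition "lhs1 \<phi> \<theta> \<mu> \<psi> = bulk.mass_form \<phi> \<psi> / \<tau> + bulk.stiff \<mu> \<psi>
  + surf.mass_form \<phi> \<psi> / (\<beta> * \<tau>) + surf.stiff \<theta> \<psi> / \<beta>"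

definition "lhs2 \<phi> \<theta> \<mu> \<eta> = a * surf.mass_form \<phi> \<eta> / \<tau> + a * surf.stiff \<theta> \<eta>
  + b * \<beta> * (\<beta> * surf.mass_form \<theta> \<eta> - surf.mass_form \<mu> \<eta>)"

definition "lhs3 \<phi> \<theta> \<mu> \<omega> = bulk.mass_form \<mu> \<omega> + surf.mass_form \<theta> \<omega> - bulk.stiff \<phi> \<omega> - surf.stiff \<phi> \<omega>
  - p * bulk.mass_form F0 \<phi> * bulk.mass_form F0 \<omega> - q * surf.mass_form G0 \<phi> * surf.mass_form G0 \<omega>"

lemmas lhs_defs = lhs1_def lhs2_def lhs3_def

lemma U_affine: "u \<in> U \<Longrightarrow> u \<in> pw_affine (closure \<Omega>) \<T>" "u \<in> U \<Longrightarrow> u \<in> pw_affine (frontier \<Omega>) \<G>"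
  using trace_pw_affine by (auto simp: pw_linear_space_eq)

lemma V_affine: "v \<in> V \<Longrightarrow> v \<in> pw_affine (frontier \<Omega>) \<G>"
  by (auto simp: pw_linear_space_eq)

lemmas form_simps = bulk.mass_form_add bulk.mass_form_cmult surf.mass_form_add surf.mass_form_cmult
  bulk.stiff_add bulk.stiff_cmult surf.stiff_add surf.stiff_cmult U_affine V_affine

lemma lhs_linear:
  assumes "\<phi> \<in> U" "\<theta> \<in> V" "\<mu> \<in> U"
  shows "linear_on U (lhs1 \<phi> \<theta> \<mu>)" "linear_on V (lhs2 \<phi> \<theta> \<mu>)" "linear_on U (lhs3 \<phi> \<theta> \<mu>)"
  using assms pos by (auto simp: linear_on_def lhs_defs form_simps field_simps)

lemma lhs_add:
  assumes "\<phi> \<in> U" "\<theta> \<in> V" "\<mu> \<in> U" "\<phi>' \<in> U" "\<theta>' \<in> V" "\<mu>' \<in> U"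
  shows "\<psi> \<in> U \<Longrightarrow> lhs1 (\<lambda>x. \<phi> x + \<phi>' x) (\<lambda>x. \<theta> x + \<theta>' x) (\<lambda>x. \<mu> x + \<mu>' x) \<psi> = lhs1 \<phi> \<theta> \<mu> \<psi> + lhs1 \<phi>' \<theta>' \<mu>' \<psi>"
    "\<eta> \<in> V \<Longrightarrow> lhs2 (\<lambda>x. \<phi> x + \<phi>' x) (\<lambda>x. \<theta> x + \<theta>' x) (\<lambda>x. \<mu> x + \<mu>' x) \<eta> = lhs2 \<phi> \<theta> \<mu> \<eta> + lhs2 \<phi>' \<theta>' \<mu>' \<eta>"
    "\<psi> \<in> U \<Longrightarrow> lhs3 (\<lambda>x. \<phi> x + \<phi>' x) (\<lambda>x. \<theta> x + \<theta>' x) (\<lambda>x. \<mu> x + \<mu>' x) \<psi> = lhs3 \<phi> \<theta> \<mu> \<psi> + lhs3 \<phi>' \<theta>' \<mu>' \<psi>"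
  using assms pos by (auto simp: lhs_defs form_simps field_simps)

lemma lhs_cmult:
  assumes "\<phi> \<in> U" "\<theta> \<in> V" "\<mu> \<in> U"
  shows "\<psi> \<in> U \<Longrightarrow> lhs1 (\<lambda>x. c * \<phi> x) (\<lambda>x. c * \<theta> x) (\<lambda>x. c * \<mu> x) \<psi> = c * lhs1 \<phi> \<theta> \<mu> \<psi>"
    "\<eta> \<in> V \<Longrightarrow> lhs2 (\<lambda>x. c * \<phi> x) (\<lambda>x. c * \<theta> x) (\<lambda>x. c * \<mu> x) \<eta> = c * lhs2 \<phi> \<theta> \<mu> \<eta>"
    "\<psi> \<in> U \<Longrightarrow> lhs3 (\<lambda>x. c * \<phi> x) (\<lambda>x. c * \<theta> x) (\<lambda>x. c * \<mu> x) \<psi> = c * lhs3 \<phi> \<theta> \<mu> \<psi>"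
  using assms pos by (auto simp: lhs_defs form_simps field_simps)

lemma homogeneous_trivial:
  assumes \<phi>: "\<phi> \<in> U" and \<theta>: "\<theta> \<in> V" and \<mu>: "\<mu> \<in> U"
    and e1: "\<And>\<psi>. \<psi> \<in> U \<Longrightarrow> lhs1 \<phi> \<theta> \<mu> \<psi> = 0" and e2: "\<And>\<eta>. \<eta> \<in> V \<Longrightarrow> lhs2 \<phi> \<theta> \<mu> \<eta> = 0"
    and e3: "\<And>\<omega>. \<omega> \<in> U \<Longrightarrow> lhs3 \<phi> \<theta> \<mu> \<omega> = 0"
  shows "(\<forall>x\<in>closure \<Omega>. \<phi> x = 0) \<and> (\<forall>x\<in>frontier \<Omega>. \<theta> x = 0) \<and> (\<forall>x\<in>closure \<Omega>. \<mu> x = 0)"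
proof -
  note aff = U_affine[OF \<phi>] U_affine[OF \<mu>] V_affine[OF \<theta>]
  have FC: "frontier \<Omega> \<subseteq> closure \<Omega>" by (auto simp: frontier_def)
  define \<zeta> where "\<zeta> = (\<lambda>x. \<theta> x + (-1 / \<beta>) * \<mu> x)"
  have \<zeta>: "\<zeta> \<in> pw_affine (frontier \<Omega>) \<G>"
    unfolding \<zeta>_def by (intro fun_subspaceD fun_subspace_pw_affine aff)
  \<comment> \<open>\<open>\<zeta>\<close> contains the trace of a bulk function and need not vanish
    off the boundary; its cut-off is the admissible test function.\<close>
  define \<eta> where "\<eta> = (\<lambda>x. if x \<in> frontier \<Omega> then \<zeta> x else 0)"
  have \<eta>: "\<eta> \<in> V" unfolding \<eta>_def by (rule surf.restrict_pw_affine[OF \<zeta>])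
  have mass_\<eta>: "surf.mass_form u \<eta> = surf.mass_form u \<zeta>" for u
    by (rule surf.mass_form_cong) (auto simp: \<eta>_def)
  have stiff_\<eta>: "surf.stiff \<theta> \<eta> = surf.stiff \<theta> \<zeta>"
    by (rule surf.stiff_cong[OF aff(5) V_affine[OF \<eta>] \<zeta>]) (simp add: \<eta>_def)
  have mass_\<zeta>: "surf.mass_form u \<zeta> = surf.mass_form u \<theta> - surf.mass_form u \<mu> / \<beta>" for u
    unfolding \<zeta>_def surf.mass_form_add surf.mass_form_cmult by simp
  have stiff_\<zeta>: "surf.stiff \<theta> \<zeta> = surf.stiff \<theta> \<theta> - surf.stiff \<theta> \<mu> / \<beta>"
    unfolding \<zeta>_def
    by (subst surf.stiff_add[OF aff(5) aff(5) fun_subspaceD(2)[OF fun_subspace_pw_affine aff(4)]])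
      (unfold surf.stiff_cmult(1)[OF aff(5) aff(4)], simp)
  have "\<beta> * surf.mass_form \<theta> \<zeta> - surf.mass_form \<mu> \<zeta> = \<beta> * surf.mass_form \<zeta> \<zeta>"
    using pos(1) mass_\<zeta>[of \<zeta>] surf.mass_form_commute[of \<zeta> \<theta>]
      surf.mass_form_commute[of \<zeta> \<mu>] by (simp add: field_simps)
  then have e2': "a * (surf.mass_form \<phi> \<zeta> / \<tau> + surf.stiff \<theta> \<zeta>) = - b * \<beta> * \<beta> * surf.mass_form \<zeta> \<zeta>"
    using e2[OF \<eta>] by (simp add: lhs2_def mass_\<eta> stiff_\<eta> algebra_simps)
  \<comment> \<open>For \<open>a = 0\<close> the left side of \<open>e2'\<close> carries no
    information, but its right side forces \<open>\<zeta>\<close> to vanish on the boundary.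
    Otherwise \<open>a\<close> can be divided out.\<close>
  have dissipation: "surf.mass_form \<phi> \<zeta> / \<tau> + surf.stiff \<theta> \<zeta> \<le> 0"
  proof (cases "a = 0")
    case True
    then have "surf.mass_form \<zeta> \<zeta> = 0" using e2' coeffs pos by simp
    then have z: "\<zeta> x = 0" if "x \<in> frontier \<Omega>" for x using surf.mass_form_eq_0[OF \<zeta>] that by blast
    have "surf.stiff \<theta> \<zeta> = 0" by (rule surf.stiff_const[OF aff(5) \<zeta> z])
    moreover have "surf.mass_form \<phi> \<zeta> = surf.mass_form \<phi> (\<lambda>x. 0 * \<zeta> x)"
      by (rule surf.mass_form_cong) (simp_all add: z)
    then have "surf.mass_form \<phi> \<zeta> = 0" unfolding surf.mass_form_cmult by simp
    ultimately show ?thesis by simp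
  next
    case False
    have "a * (surf.mass_form \<phi> \<zeta> / \<tau> + surf.stiff \<theta> \<zeta>) \<le> 0"
      unfolding e2' using coeffs pos surf.mass_form_nonneg[of \<zeta>] by simp
    then show ?thesis using False coeffs(1) by (simp add: mult_le_0_iff)
  qed
  \<comment> \<open>\<open>A\<close> is the pairing shared by the first and the third equation.
    \<open>A1\<close> bounds \<open>A / \<tau>\<close> above by minus the gradient energies of
    \<open>\<mu>\<close> and \<open>\<theta>\<close>, while \<open>A2\<close> writes
    \<open>A\<close> as a sum of nonnegative terms, so all of them vanish.\<close>
  define A where "A = bulk.mass_form \<phi> \<mu> + surf.mass_form \<phi> \<theta>"
  have A1: "A / \<tau> + bulk.stiff \<mu> \<mu> + surf.stiff \<theta> \<theta> \<le> 0"
  proof -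
    have "bulk.mass_form \<phi> \<mu> / \<tau> + bulk.stiff \<mu> \<mu> + surf.mass_form \<phi> \<mu> / (\<beta> * \<tau>) + surf.stiff \<theta> \<mu> / \<beta> = 0"
      using e1[OF \<mu>] by (simp add: lhs1_def)
    then show ?thesis
      using dissipation unfolding mass_\<zeta> stiff_\<zeta> A_def by (simp add: diff_divide_distrib add_divide_distrib)
  qed
  have A2: "A = bulk.stiff \<phi> \<phi> + surf.stiff \<phi> \<phi> + p * (bulk.mass_form F0 \<phi>)\<^sup>2 + q * (surf.mass_form G0 \<phi>)\<^sup>2"
    using e3[OF \<phi>] unfolding lhs3_def A_def
    by (simp add: bulk.mass_form_commute[of \<mu>] surf.mass_form_commute[of \<theta>] power2_eq_square)
  have nn: "bulk.stiff \<phi> \<phi> \<ge> 0" "surf.stiff \<phi> \<phi> \<ge> 0" "bulk.stiff \<mu> \<mu> \<ge> 0" "surf.stiff \<theta> \<theta> \<ge> 0"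
    "p * (bulk.mass_form F0 \<phi>)\<^sup>2 \<ge> 0" "q * (surf.mass_form G0 \<phi>)\<^sup>2 \<ge> 0"
    using bulk.stiff_nonneg surf.stiff_nonneg aff pq by auto
  have "A \<ge> 0" using A2 nn by linarith
  then have "A / \<tau> \<ge> 0" using pos by simp
  then have "A / \<tau> = 0" "bulk.stiff \<mu> \<mu> = 0" "surf.stiff \<theta> \<theta> = 0" using A1 nn by linarith+
  moreover from this have "bulk.stiff \<phi> \<phi> = 0" using A2 nn pos by simp
  ultimately obtain c m t where c: "\<And>x. x \<in> closure \<Omega> \<Longrightarrow> \<phi> x = c"
    and m: "\<And>x. x \<in> closure \<Omega> \<Longrightarrow> \<mu> x = m" and t: "\<And>x. x \<in> frontier \<Omega> \<Longrightarrow> \<theta> x = t"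
    using bulk.stiff_eq_0[OF aff(1)] bulk.stiff_eq_0[OF aff(3)] surf.stiff_eq_0[OF aff(5)] by metis
  define I where "I = (\<lambda>x. if x \<in> closure \<Omega> then 1 else 0 :: real)"
  have I: "I \<in> U" unfolding I_def by (rule bulk.pw_linear_space_const)
  have bulk_const: "bulk.mass_form u v = d * bulk.mass v" if "\<And>x. x \<in> closure \<Omega> \<Longrightarrow> u x = d" for u v d
    using bulk.mesh_vertices_subset that unfolding bulk.mass_form_def bulk.mass_cmult[symmetric]
    by (intro bulk.mass_cong) auto
  have surf_const: "surf.mass_form u v = d * surf.mass v" if "\<And>x. x \<in> frontier \<Omega> \<Longrightarrow> u x = d" for u v d
    using surf.mesh_vertices_subset that unfolding surf.mass_form_def surf.mass_cmult[symmetric]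
    by (intro surf.mass_cong) auto
  have mI: "bulk.mass I > 0" "surf.mass I > 0"
  proof -
    have "bulk.mass I = bulk.mass (\<lambda>_. 1)" "surf.mass I = surf.mass (\<lambda>_. 1)"
      using bulk.mesh_vertices_subset surf.mesh_vertices_subset FC
      by (auto simp: I_def intro!: bulk.mass_cong surf.mass_cong)
    then show "bulk.mass I > 0" "surf.mass I > 0" using bulk.mass_one_pos surf.mass_one_pos by simp_all
  qed
  have "bulk.stiff \<mu> I = 0" "surf.stiff \<theta> I = 0"
    by (rule bulk.stiff_const[OF aff(3) U_affine(1)[OF I], of 1], simp add: I_def)
      (rule surf.stiff_const[OF aff(5) U_affine(2)[OF I], of 1], use FC in \<open>auto simp: I_def\<close>)
  then have "c * (bulk.mass I / \<tau> + surf.mass I / (\<beta> * \<tau>)) = 0"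
    using e1[OF I] c FC by (simp add: lhs1_def bulk_const[of \<phi> c] surf_const[of \<phi> c] subset_iff algebra_simps)
  moreover have "bulk.mass I / \<tau> + surf.mass I / (\<beta> * \<tau>) > 0" using mI pos by (intro add_pos_pos) auto
  ultimately have c0: "c = 0" by simp
  \<comment> \<open>Once \<open>\<phi>\<close> is zero, the third equation sees only the constants
    \<open>m\<close> and \<open>t\<close>, weighted by the bulk and surface mass of the test
    function.\<close>
  have const: "m * bulk.mass \<omega> + t * surf.mass \<omega> = 0" if \<omega>: "\<omega> \<in> U" for \<omega>
  proof -
    have "bulk.stiff \<phi> \<omega> = 0" "surf.stiff \<phi> \<omega> = 0"
      using c FC bulk.stiff_const[OF U_affine(1)[OF \<omega>] aff(1)] surf.stiff_const[OF U_affine(2)[OF \<omega>] aff(2)]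
        bulk.stiff_commute surf.stiff_commute by (metis subsetD)+
    moreover have "bulk.mass_form F0 \<phi> = 0" "surf.mass_form G0 \<phi> = 0"
      using c FC bulk_const[of \<phi> c F0] surf_const[of \<phi> c G0]
      by (auto simp: bulk.mass_form_commute[of F0] surf.mass_form_commute[of G0] c0)
    ultimately show ?thesis
      using e3[OF \<omega>] m t by (simp add: lhs3_def bulk_const[of \<mu> m] surf_const[of \<theta> t])
  qed
  obtain v where v: "v \<in> mesh_vertices \<T>" "v \<notin> frontier \<Omega>" using interior_vertex by blast
  define \<omega> where "\<omega> = interp (closure \<Omega>) \<T> (\<lambda>x. if x = v then 1 else 0)"
  have \<omega>: "\<omega> \<in> U" "\<And>x. x \<in> mesh_vertices \<T> \<Longrightarrow> \<omega> x = (if x = v then 1 else 0)"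
    using bulk.interp_spec by (simp_all add: \<omega>_def)
  have "surf.mass \<omega> = surf.mass (\<lambda>x. 0 * I x)"
  proof (rule surf.mass_cong)
    fix x assume "x \<in> mesh_vertices \<G>"
    then have "x \<in> mesh_vertices \<T>" "x \<noteq> v"
      using v surf_vertices_subset surf.mesh_vertices_subset by auto
    then show "\<omega> x = 0 * I x" using \<omega>(2) by simp
  qed
  then have "surf.mass \<omega> = 0" unfolding surf.mass_cmult by simp
  moreover have "bulk.mass \<omega> \<noteq> 0"
  proof
    assume 0: "bulk.mass \<omega> = 0"
    have "\<omega> v = 0" by (rule bulk.mass_eq_0[OF _ 0 v(1)]) (simp add: \<omega>(2))
    then show False using \<omega>(2)[OF v(1)] by simp
  qed
  ultimately have m0: "m = 0" using const[OF \<omega>(1)] by simp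
  then have "t = 0" using const[OF I] mI by simp
  then show ?thesis using c m t c0 m0 by simp
qed

text \<open>Ordering the unknowns as \<open>\<phi>\<close>, \<open>\<theta>\<close>,
  \<open>\<mu>\<close> matches the test spaces of the three equations, so that trial and test space
  coincide. The equations may then be added into one, since their test functions vary
  independently.\<close>

lemma scheme_ex1:
  assumes l: "linear_on U l1" "linear_on V l2" "linear_on U l3"
  shows "\<exists>!(\<phi>, \<theta>, \<mu>). \<phi> \<in> U \<and> \<theta> \<in> V \<and> \<mu> \<in> U \<and> (\<forall>\<psi>\<in>U. lhs1 \<phi> \<theta> \<mu> \<psi> = l1 \<psi>)
    \<and> (\<forall>\<eta>\<in>V. lhs2 \<phi> \<theta> \<mu> \<eta> = l2 \<eta>) \<and> (\<forall>\<omega>\<in>U. lhs3 \<phi> \<theta> \<mu> \<omega> = l3 \<omega>)"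
proof -
  let ?X = "fun_sum U (fun_sum V U)"
  define P1 where "P1 w = w \<circ> Inl" for w :: "'a + 'a + 'a \<Rightarrow> real"
  define P2 where "P2 w = w \<circ> Inr \<circ> Inl" for w :: "'a + 'a + 'a \<Rightarrow> real"
  define P3 where "P3 w = w \<circ> Inr \<circ> Inr" for w :: "'a + 'a + 'a \<Rightarrow> real"
  note P_defs = P1_def P2_def P3_def
  have X_iff: "w \<in> ?X \<longleftrightarrow> P1 w \<in> U \<and> P2 w \<in> V \<and> P3 w \<in> U" for w
    by (simp add: fun_sum_def P_defs)
  have P_add: "P1 (\<lambda>i. u i + v i) = (\<lambda>x. P1 u x + P1 v x)" "P2 (\<lambda>i. u i + v i) = (\<lambda>x. P2 u x + P2 v x)"
    "P3 (\<lambda>i. u i + v i) = (\<lambda>x. P3 u x + P3 v x)" for u v by (auto simp: P_defs)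
  have P_cmult: "P1 (\<lambda>i. c * u i) = (\<lambda>x. c * P1 u x)" "P2 (\<lambda>i. c * u i) = (\<lambda>x. c * P2 u x)"
    "P3 (\<lambda>i. c * u i) = (\<lambda>x. c * P3 u x)" for u c by (auto simp: P_defs)
  define T where "T u v w = case_sum u (case_sum v w)" for u v w :: "'a \<Rightarrow> real"
  have PT: "P1 (T u v w) = u" "P2 (T u v w) = v" "P3 (T u v w) = w" for u v w
    by (auto simp: P_defs T_def)
  have TP: "T (P1 w) (P2 w) (P3 w) = w" for w
    by (auto simp: P_defs T_def fun_eq_iff split: sum.split)
  define B where "B w z = lhs1 (P1 w) (P2 w) (P3 w) (P1 z) + lhs2 (P1 w) (P2 w) (P3 w) (P2 z)
    + lhs3 (P1 w) (P2 w) (P3 w) (P3 z)" for w z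
  define l where "l z = l1 (P1 z) + l2 (P2 z) + l3 (P3 z)" for z
  have zero: "(\<lambda>x. 0) \<in> U" "(\<lambda>x. 0) \<in> V"
    using fun_subspace_pw_linear_space by (auto simp: fun_subspace_def)
  have at_zero: "f (\<lambda>x. 0) = 0" if "linear_on W f" "(\<lambda>x. 0) \<in> W" for W f
    using linear_onD(2)[OF that, of 0] by simp
  \<comment> \<open>Each equation is recovered from the sum by setting the other two test components
    to zero, where every linear functional vanishes.\<close>
  have B_iff: "(\<forall>z\<in>?X. B w z = l' z) \<longleftrightarrow>
      (\<forall>\<psi>\<in>U. lhs1 (P1 w) (P2 w) (P3 w) \<psi> = l1' \<psi>) \<and> (\<forall>\<eta>\<in>V. lhs2 (P1 w) (P2 w) (P3 w) \<eta> = l2' \<eta>)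
      \<and> (\<forall>\<omega>\<in>U. lhs3 (P1 w) (P2 w) (P3 w) \<omega> = l3' \<omega>)"
    if w: "w \<in> ?X" and l': "\<And>z. l' z = l1' (P1 z) + l2' (P2 z) + l3' (P3 z)"
      and lin: "linear_on U l1'" "linear_on V l2'" "linear_on U l3'" for w l' l1' l2' l3'
  proof (intro iffI)
    assume *: "\<forall>z\<in>?X. B w z = l' z"
    note L = lhs_linear[of "P1 w" "P2 w" "P3 w"]
    have w': "P1 w \<in> U" "P2 w \<in> V" "P3 w \<in> U" using w X_iff by auto
    note z = at_zero[OF lin(1) zero(1)] at_zero[OF lin(2) zero(2)] at_zero[OF lin(3) zero(1)]
      at_zero[OF L(1)[OF w'] zero(1)] at_zero[OF L(2)[OF w'] zero(2)] at_zero[OF L(3)[OF w'] zero(1)]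
    have "lhs1 (P1 w) (P2 w) (P3 w) \<psi> = l1' \<psi>" if "\<psi> \<in> U" for \<psi>
      using bspec[OF *, of "T \<psi> (\<lambda>x. 0) (\<lambda>x. 0)"] that zero z by (simp add: X_iff PT B_def l')
    moreover have "lhs2 (P1 w) (P2 w) (P3 w) \<eta> = l2' \<eta>" if "\<eta> \<in> V" for \<eta>
      using bspec[OF *, of "T (\<lambda>x. 0) \<eta> (\<lambda>x. 0)"] that zero z by (simp add: X_iff PT B_def l')
    moreover have "lhs3 (P1 w) (P2 w) (P3 w) \<omega> = l3' \<omega>" if "\<omega> \<in> U" for \<omega>
      using bspec[OF *, of "T (\<lambda>x. 0) (\<lambda>x. 0) \<omega>"] that zero z by (simp add: X_iff PT B_def l')
    ultimately show "(\<forall>\<psi>\<in>U. lhs1 (P1 w) (P2 w) (P3 w) \<psi> = l1' \<psi>) \<and> (\<forall>\<eta>\<in>V. lhs2 (P1 w) (P2 w) (P3 w) \<eta> = l2' \<eta>)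
      \<and> (\<forall>\<omega>\<in>U. lhs3 (P1 w) (P2 w) (P3 w) \<omega> = l3' \<omega>)" by blast
  qed (auto simp: X_iff B_def l')
  have "\<exists>!w. w \<in> ?X \<and> (\<forall>z\<in>?X. B w z = l z)"
  proof (rule nodal_galerkin)
    show "nodal_space ?X (mesh_vertices \<T> <+> mesh_vertices \<G> <+> mesh_vertices \<T>)"
      by (intro nodal_space_fun_sum bulk.nodal_space_pw_linear surf.nodal_space_pw_linear)
    show "linear_on ?X (\<lambda>w. B w z)" if "z \<in> ?X" for z
      using that unfolding linear_on_def
      by (auto simp: B_def X_iff P_add P_cmult lhs_add lhs_cmult distrib_left)
    show "linear_on ?X (B w)" if "w \<in> ?X" for w
    proof -
      have w: "P1 w \<in> U" "P2 w \<in> V" "P3 w \<in> U" using that X_iff by auto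
      note L = lhs_linear[OF w]
      show ?thesis
        unfolding linear_on_def
        by (auto simp: B_def X_iff P_add P_cmult linear_onD[OF L(1)] linear_onD[OF L(2)] linear_onD[OF L(3)] distrib_left)
    qed
    show "linear_on ?X l"
      unfolding linear_on_def
      by (auto simp: l_def X_iff P_add P_cmult linear_onD[OF l(1)] linear_onD[OF l(2)] linear_onD[OF l(3)] distrib_left)
    fix w assume w: "w \<in> ?X" and "\<forall>z\<in>?X. B w z = 0"
    then have "(\<forall>\<psi>\<in>U. lhs1 (P1 w) (P2 w) (P3 w) \<psi> = 0) \<and> (\<forall>\<eta>\<in>V. lhs2 (P1 w) (P2 w) (P3 w) \<eta> = 0)
      \<and> (\<forall>\<omega>\<in>U. lhs3 (P1 w) (P2 w) (P3 w) \<omega> = 0)"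
      using B_iff[OF w, of "\<lambda>_. 0" "\<lambda>_. 0" "\<lambda>_. 0" "\<lambda>_. 0"] by (simp add: linear_on_def)
    then have "(\<forall>x\<in>closure \<Omega>. P1 w x = 0) \<and> (\<forall>x\<in>frontier \<Omega>. P2 w x = 0) \<and> (\<forall>x\<in>closure \<Omega>. P3 w x = 0)"
      using w unfolding X_iff by (intro homogeneous_trivial) auto
    then show "\<forall>i\<in>mesh_vertices \<T> <+> mesh_vertices \<G> <+> mesh_vertices \<T>. w i = 0"
      using bulk.mesh_vertices_subset surf.mesh_vertices_subset by (auto simp: P_defs)
  qed
  then obtain w where w: "w \<in> ?X" "\<forall>z\<in>?X. B w z = l z" and uniq: "\<And>w'. w' \<in> ?X \<Longrightarrow> \<forall>z\<in>?X. B w' z = l z \<Longrightarrow> w' = w"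
    by (auto elim: ex1E)
  note iff = B_iff[OF _ l_def l]
  show ?thesis
  proof (rule ex1I[of _ "(P1 w, P2 w, P3 w)"])
    show "case (P1 w, P2 w, P3 w) of (\<phi>, \<theta>, \<mu>) \<Rightarrow> \<phi> \<in> U \<and> \<theta> \<in> V \<and> \<mu> \<in> U \<and> (\<forall>\<psi>\<in>U. lhs1 \<phi> \<theta> \<mu> \<psi> = l1 \<psi>)
      \<and> (\<forall>\<eta>\<in>V. lhs2 \<phi> \<theta> \<mu> \<eta> = l2 \<eta>) \<and> (\<forall>\<omega>\<in>U. lhs3 \<phi> \<theta> \<mu> \<omega> = l3 \<omega>)"
      using w iff[OF w(1)] by (simp add: X_iff)
    fix y assume y: "case y of (\<phi>, \<theta>, \<mu>) \<Rightarrow> \<phi> \<in> U \<and> \<theta> \<in> V \<and> \<mu> \<in> U \<and> (\<forall>\<psi>\<in>U. lhs1 \<phi> \<theta> \<mu> \<psi> = l1 \<psi>)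
      \<and> (\<forall>\<eta>\<in>V. lhs2 \<phi> \<theta> \<mu> \<eta> = l2 \<eta>) \<and> (\<forall>\<omega>\<in>U. lhs3 \<phi> \<theta> \<mu> \<omega> = l3 \<omega>)"
    obtain \<phi> \<theta> \<mu> where yy: "y = (\<phi>, \<theta>, \<mu>)" by (cases y)
    have X: "T \<phi> \<theta> \<mu> \<in> ?X" using y by (simp add: yy X_iff PT)
    have "T \<phi> \<theta> \<mu> = w" using y by (intro uniq X) (simp add: yy iff[OF X] PT)
    then show "y = (P1 w, P2 w, P3 w)" using PT yy by auto
  qed
qed

section \<open>The integrals of the scheme as mass and stiffness forms\<close>

lemma diff_quot_mass_form:
  "bulk.mass_form (diff_quot \<tau> u v) w = (bulk.mass_form u w - bulk.mass_form v w) / \<tau>"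
  "surf.mass_form (diff_quot \<tau> u v) w = (surf.mass_form u w - surf.mass_form v w) / \<tau>"
proof -
  have "diff_quot \<tau> u v = (\<lambda>x. (1 / \<tau>) * (u x - v x))" by (simp add: fun_eq_iff diff_quot_def)
  then show "bulk.mass_form (diff_quot \<tau> u v) w = (bulk.mass_form u w - bulk.mass_form v w) / \<tau>"
    "surf.mass_form (diff_quot \<tau> u v) w = (surf.mass_form u w - surf.mass_form v w) / \<tau>"
    by (simp_all only: bulk.mass_form_cmult bulk.mass_form_diff surf.mass_form_cmult surf.mass_form_diff) simp_all
qed

lemma vol_int_h_mass: "vol_int_h \<Omega> \<T> (\<lambda>x. u x * v x) = bulk.mass_form u v"
  by (simp add: vol_int_h_def vol_int_def bulk.mass_form_def bulk.mass_def)

lemma surf_int_h_mass: "surf_int_h \<Omega> \<G> (\<lambda>x. u x * v x) = surf.mass_form u v"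
  by (simp add: surf_int_h_def surf_int_def surf.mass_form_def surf.mass_def)

lemma vol_int_stiff: "vol_int \<Omega> (\<lambda>x. grad u x \<bullet> grad v x) = bulk.stiff u v"
  by (simp add: vol_int_def bulk.stiff_def)

lemma surf_int_stiff: "surf_int \<Omega> (\<lambda>x. surf_grad \<Omega> u x \<bullet> surf_grad \<Omega> v x) = surf.stiff u v"
  by (simp add: surf_int_def surf.stiff_def)

end

lemma coeff_props: "coeff_fin \<xi> \<ge> 0" "coeff_inf \<xi> \<ge> 0" "coeff_fin \<xi> + coeff_inf \<xi> = 1"
proof -
  have "1 + enn2real \<xi> > 0" using enn2real_nonneg[of \<xi>] by linarith
  then show "coeff_fin \<xi> \<ge> 0" "coeff_inf \<xi> \<ge> 0" "coeff_fin \<xi> + coeff_inf \<xi> = 1"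
    by (auto simp: coeff_fin_def coeff_inf_def simp flip: add_divide_distrib)
qed

lemma mesh_family_bulk_surface_mesh:
  fixes \<Omega> :: "'a::euclidean_space set"
  assumes "DIM('a) \<ge> 2" "convex_polyhedral_domain \<Omega>" "mesh_family \<Omega> \<T> \<T>\<Gamma>" "h > 0"
  shows "bulk_surface_mesh \<Omega> (\<T> h) (\<T>\<Gamma> h) h"
proof
  show "\<exists>K\<in>\<T> h. closure L = closure K \<inter> frontier \<Omega>" if "L \<in> \<T>\<Gamma> h" for L
    using assms(3,4) that unfolding mesh_family_def by blast
qed (use assms in \<open>auto simp: mesh_family_def\<close>)


text \<open>Inserting the updates of \<open>r\<close> and \<open>s\<close> into the third equation of the scheme leaves a square
  linear system for \<open>\<phi>\<close>, \<open>\<theta>\<close>, \<open>\<mu>\<close>.  As \<open>(sqrt E)\<^sup>2 = \<bar>E\<bar>\<close> also for negative \<open>E\<close>, the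
  resulting rank one terms have the right sign.\<close>

theorem lemma2p4:
  fixes \<Omega> :: "(real ^ 'd) set"
    and \<T> \<T>\<Gamma> :: "real \<Rightarrow> (real ^ 'd) set set"
    and F G :: "real \<Rightarrow> real"
    and \<beta> \<tau> h r0 s0 :: real
    and \<xi> :: ennreal
    and \<phi>0 :: "real ^ 'd \<Rightarrow> real"
  assumes "CARD('d) \<in> {2, 3}"
    and "convex_polyhedral_domain \<Omega>"
    and "mesh_family \<Omega> \<T> \<T>\<Gamma>"
    and "admissible_potentials \<Omega> \<T> \<T>\<Gamma> F G"
    and "\<beta> > 0" and "\<tau> > 0" and "h > 0"
    and "\<phi>0 \<in> bulk_space \<Omega> (\<T> h)"
  shows "\<exists>!z. scheme_solution \<Omega> (\<T> h) (\<T>\<Gamma> h) F G \<beta> \<xi> \<tau> \<phi>0 r0 s0 z"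
proof -
  define F0 where "F0 = (\<lambda>x. deriv F (\<phi>0 x))"
  define G0 where "G0 = (\<lambda>x. deriv G (\<phi>0 x))"
  define e where "e = 1 / sqrt (bulk_energy \<Omega> (\<T> h) F \<phi>0)"
  define g where "g = 1 / sqrt (surf_energy \<Omega> (\<T>\<Gamma> h) G \<phi>0)"
  have mesh: "bulk_surface_mesh \<Omega> (\<T> h) (\<T>\<Gamma> h) h"
    using assms by (intro mesh_family_bulk_surface_mesh) auto
  \<comment> \<open>The weight \<open>e\<^sup>2 / 2\<close> is the product of the factor
    \<open>e\<close> multiplying \<open>r\<close> in the third equation and the factor
    \<open>e / 2\<close> in the update of \<open>r\<close>; likewise for \<open>g\<close> and
    \<open>s\<close>.\<close>
  interpret linear_scheme \<Omega> "\<T> h" "\<T>\<Gamma> h" h \<beta> \<tau> "coeff_fin \<xi>" "coeff_inf \<xi>" "e\<^sup>2 / 2" "g\<^sup>2 / 2" F0 G0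
    by (rule linear_scheme.intro[OF mesh], unfold_locales) (use assms coeff_props in auto)
  define R where "R \<phi> = r0 + e / 2 * (bulk.mass_form F0 \<phi> - bulk.mass_form F0 \<phi>0)" for \<phi>
  define Q where "Q \<phi> = s0 + g / 2 * (surf.mass_form G0 \<phi> - surf.mass_form G0 \<phi>0)" for \<phi>
  define l1 where "l1 \<psi> = bulk.mass_form \<phi>0 \<psi> / \<tau> + surf.mass_form \<phi>0 \<psi> / (\<beta> * \<tau>)" for \<psi>
  define l2 where "l2 \<eta> = coeff_fin \<xi> * surf.mass_form \<phi>0 \<eta> / \<tau>" for \<eta>
  \<comment> \<open>These are the parts of \<open>R\<close> and \<open>Q\<close> that do not involve
    the new \<open>\<phi>\<close>; the other parts form the rank one terms of
    \<open>lhs3\<close>.\<close>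
  define l3 where "l3 \<omega> = e * (r0 - e / 2 * bulk.mass_form F0 \<phi>0) * bulk.mass_form F0 \<omega>
    + g * (s0 - g / 2 * surf.mass_form G0 \<phi>0) * surf.mass_form G0 \<omega>" for \<omega>
  have l: "linear_on U l1" "linear_on V l2" "linear_on U l3"
    using pos by (auto simp: linear_on_def l1_def l2_def l3_def form_simps field_simps)
  define P where "P \<phi> \<theta> \<mu> \<longleftrightarrow> \<phi> \<in> U \<and> \<theta> \<in> V \<and> \<mu> \<in> U \<and> (\<forall>\<psi>\<in>U. lhs1 \<phi> \<theta> \<mu> \<psi> = l1 \<psi>)
    \<and> (\<forall>\<eta>\<in>V. lhs2 \<phi> \<theta> \<mu> \<eta> = l2 \<eta>) \<and> (\<forall>\<omega>\<in>U. lhs3 \<phi> \<theta> \<mu> \<omega> = l3 \<omega>)" for \<phi> \<theta> \<mu>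
  \<comment> \<open>The scalars are functions of \<open>\<phi>\<close>, so existence and uniqueness
    for the triple carry over to the quintuple, in which \<open>\<mu>\<close> and
    \<open>\<theta>\<close> change places.\<close>
  have iff: "scheme_solution \<Omega> (\<T> h) (\<T>\<Gamma> h) F G \<beta> \<xi> \<tau> \<phi>0 r0 s0 (\<phi>, \<mu>, \<theta>, r, s) \<longleftrightarrow>
      P \<phi> \<theta> \<mu> \<and> r = R \<phi> \<and> s = Q \<phi>" for \<phi> \<mu> \<theta> r s
  proof -
    have E: "r / sqrt (bulk_energy \<Omega> (\<T> h) F \<phi>0) = r * e" "s / sqrt (surf_energy \<Omega> (\<T>\<Gamma> h) G \<phi>0) = s * g"
      "1 / (2 * sqrt (bulk_energy \<Omega> (\<T> h) F \<phi>0)) = e / 2" "1 / (2 * sqrt (surf_energy \<Omega> (\<T>\<Gamma> h) G \<phi>0)) = g / 2"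
      by (simp_all add: e_def g_def)
    have 1: "bulk.mass_form (diff_quot \<tau> \<phi> \<phi>0) \<psi> + bulk.stiff \<mu> \<psi> + 1 / \<beta> * surf.mass_form (diff_quot \<tau> \<phi> \<phi>0) \<psi>
        + 1 / \<beta> * surf.stiff \<theta> \<psi> = 0 \<longleftrightarrow> lhs1 \<phi> \<theta> \<mu> \<psi> = l1 \<psi>" for \<psi>
      by (simp add: diff_quot_mass_form lhs1_def l1_def diff_divide_distrib algebra_simps)
    have 2: "coeff_fin \<xi> * surf.mass_form (diff_quot \<tau> \<phi> \<phi>0) \<eta> + coeff_fin \<xi> * surf.stiff \<theta> \<eta>
        + coeff_inf \<xi> * \<beta> * surf.mass_form (\<lambda>x. \<beta> * \<theta> x - \<mu> x) \<eta> = 0 \<longleftrightarrow> lhs2 \<phi> \<theta> \<mu> \<eta> = l2 \<eta>" for \<eta>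
      using pos by (simp add: diff_quot_mass_form surf.mass_form_diff surf.mass_form_cmult lhs2_def l2_def field_simps)
    have 3: "bulk.mass_form \<mu> \<omega> + surf.mass_form \<theta> \<omega> = bulk.stiff \<phi> \<omega> + surf.stiff \<phi> \<omega>
        + R \<phi> * e * bulk.mass_form F0 \<omega> + Q \<phi> * g * surf.mass_form G0 \<omega> \<longleftrightarrow> lhs3 \<phi> \<theta> \<mu> \<omega> = l3 \<omega>" for \<omega>
      unfolding R_def Q_def lhs3_def l3_def by (simp add: power2_eq_square algebra_simps)
    have R: "r0 + e / 2 * bulk.mass_form F0 (\<lambda>x. \<phi> x - \<phi>0 x) = R \<phi>"
      "s0 + g / 2 * surf.mass_form G0 (\<lambda>x. \<phi> x - \<phi>0 x) = Q \<phi>"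
      by (simp_all only: R_def Q_def bulk.mass_form_diff surf.mass_form_diff)
    show ?thesis
      unfolding scheme_solution_def prod.case E vol_int_h_mass surf_int_h_mass vol_int_stiff surf_int_stiff
        F0_def[symmetric] G0_def[symmetric] R 1 2 P_def
      using 3 by auto
  qed
  have "\<exists>!(\<phi>, \<theta>, \<mu>). P \<phi> \<theta> \<mu>" unfolding P_def by (rule scheme_ex1[OF l])
  then obtain \<phi> \<theta> \<mu> where P: "P \<phi> \<theta> \<mu>"
    and uniq: "\<And>\<phi>' \<theta>' \<mu>'. P \<phi>' \<theta>' \<mu>' \<Longrightarrow> \<phi>' = \<phi> \<and> \<theta>' = \<theta> \<and> \<mu>' = \<mu>"
    by (auto simp: Ex1_def)
  show ?thesis
  proof (rule ex1I[of _ "(\<phi>, \<mu>, \<theta>, R \<phi>, Q \<phi>)"])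
    show "scheme_solution \<Omega> (\<T> h) (\<T>\<Gamma> h) F G \<beta> \<xi> \<tau> \<phi>0 r0 s0 (\<phi>, \<mu>, \<theta>, R \<phi>, Q \<phi>)"
      using P iff by simp
    fix z assume "scheme_solution \<Omega> (\<T> h) (\<T>\<Gamma> h) F G \<beta> \<xi> \<tau> \<phi>0 r0 s0 z"
    then show "z = (\<phi>, \<mu>, \<theta>, R \<phi>, Q \<phi>)"
      using iff uniq by (cases z) auto
  qed
qed

end
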